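(* Let $M$ be a non-cylindrical ruled surface in $\mathbb{E}_1^3$ parametrized by $X(s,t)=\gamma(s)+t(1,s,s)$, and let $\vec a=(0,1,1)$. If $M$ is a translating soliton (with respect to a vector $\vec v$), then $\langle\gamma',\vec a\rangle\neq0$ and $\vec a$ is orthogonal to $\vec v$. Furthermore, after dilations and translations, the base curve $\gamma$ is given by $$\gamma(s)=(x(s),\,z(s)+\Phi(s),\,z(s)),$$ according to the following cases, where $\epsilon=\langle N,N\rangle\in\{-1,1\}$ and $b\in\mathbb{R}$ denotes a constant: (1) Case $\vec v=(0,1,1)$. Then, with $a\in\mathbb{R}$, $$\Phi(s)=\frac{1}{2\epsilon}\log(2\epsilon s+a),\qquad x(s)=\frac{a\log(2\epsilon s+a)}{4}-\frac{s}{2\epsilon},$$ $$z(s)=-\frac{(a^2+4)\log(2\epsilon s+a)}{16\epsilon}+bs-\frac{s^2\epsilon}{8}.$$ (2) Case $\vec v=(1,v_2,v_2)$. Depending on the integration constants, we have one of the following. (a) $$\Phi(s)=\frac{1}{\epsilon(s-v_2)},\qquad x(s)=\frac1\epsilon\left(\log(s-v_2)-\frac{v_2}{s-v_2}\right),$$ $$z(s)=\frac{1}{2\epsilon}\left(2v_2\log(s-v_2)-\frac{1+v_2^2}{s-v_2}\right)+bs.$$ (b) For some $a\in\mathbb{R}$, $a\neq0$: if $\mathrm{sgn}(\epsilon)=\mathrm{sgn}(a)$, then with $p=\sqrt{\epsilon/a}$ and $\phi(s)=p(s-v_2)$, $$\Phi(s)=-\frac{1}{ap}\arctan\phi(s),\qquad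 x(s)=\frac{1}{2\epsilon}\log(1+\phi(s)^2)+\frac{v_2}{ap}\arctan\phi(s),$$ $$z(s)=\frac{\left(p^2(v_2^2+1)-1\right)\arctan\phi(s)+p\,v_2\log(1+\phi(s)^2)}{2\epsilon}+bs;$$ or, if $\mathrm{sgn}(\epsilon)=-\mathrm{sgn}(a)$, then with $p=\sqrt{-\epsilon/a}$ and $\phi(s)=p(s-v_2)$, $$\Phi(s)=-\frac{1}{2pa}\log\frac{1+\phi(s)}{1-\phi(s)},\qquad x(s)=\frac{1}{2\epsilon}\log(1-\phi(s)^2)+\frac{v_2}{2ap}\log\frac{1+\phi(s)}{1-\phi(s)},$$ $$z(s)=\frac{\epsilon v_2}{2}\log(1-\phi(s)^2)+\frac{1-a\epsilon+v_2^2}{2ap}\,\mathrm{arctanh}\,\phi(s)+bs.$$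
   Context: $\mathbb{E}_1^3$ is $\mathbb{R}^3$ with coordinates $(x,y,z)$ and metric $\langle\,,\rangle=dx^2+dy^2-dz^2$. A surface is non-degenerate if its induced metric is non-degenerate. For a non-degenerate surface let $N$ be the unit normal vector field, $\epsilon=\langle N,N\rangle\in\{-1,1\}$ ($\epsilon=-1$ if the induced metric is Riemannian, $\epsilon=1$ if it is Lorentzian), and $\sigma$ the second fundamental form, $\nabla^0_UV=\nabla_UV+\sigma(U,V)$, where $\nabla^0$ and $\nabla$ are the Levi-Civita connections of $\mathbb{E}_1^3$ and of the surface. The mean curvature vector is $\vec H=\frac12\,\mathrm{trace}(\sigma)$, and the mean curvature $H$ is defined by $\vec H=HN$. A translating soliton with respect to a vector $\vec v$ is a non-degenerate surface with $2H=\langle N,\vec v\rangle$ at every point. A ruled surface is parametrized by $X(s,t)=\gamma(s)+t\,w(s)$, where $\gamma$ is a regular curve (the base curve) and $w(s)$ is a nowhere vanishing vector field along $\gamma$; it is cylindrical if its rulings $t\mapsto X(s,t)$ are all parallel to a fixed direction. Here $w(s)=(1,s,s)$, so $w'(s)=\vec a=(0,1,1)$ is lightlike. For $\lambda>0$, if $M$ is a translating soliton with respect to $\vec v$, then the dilation $\lambda M$ is a translating soliton with respect to $\vec v/\lambda$, with rulings parallel to those of $M$.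
   Formalization: In (2)(b), sgn ε = sgn a, the denominator of z is corrected from 2ε to 2εp; γ is replaced by a base curve orthogonal to the rulings; the classification assumes v≠0; dilations may have negative factor; log means log|·|, with arctanh extended accordingly. *)

theory Defs
  imports "HOL-Analysis.Analysis"
begin

text \<open>The metric of \<open>E\<^sub>1\<^sup>3\<close>.\<close>

definition mink :: "real^3 \<Rightarrow> real^3 \<Rightarrow> real" where
  "mink p q = p $ 1 * q $ 1 + p $ 2 * q $ 2 - p $ 3 * q $ 3"

text \<open>\<open>smooth_on S f\<close>, meant for open \<open>S\<close> in a Euclidean space: all iterated directional
  derivatives of \<open>f\<close> exist and are differentiable on \<open>S\<close>, i.e. \<open>f\<close> is of class \<open>C\<^sup>\<infinity>\<close> on \<open>S\<close>.\<close>

primrec iterated_deriv ::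
    "('a::euclidean_space \<Rightarrow> 'b::real_normed_vector) \<Rightarrow> 'a list \<Rightarrow> 'a \<Rightarrow> 'b" where
  "iterated_deriv f [] = f"
| "iterated_deriv f (d # ds) = (\<lambda>x. frechet_derivative (iterated_deriv f ds) (at x) d)"

definition smooth_on ::
    "'a::euclidean_space set \<Rightarrow> ('a \<Rightarrow> 'b::real_normed_vector) \<Rightarrow> bool" where
  "smooth_on S f \<longleftrightarrow> (\<forall>ds. \<forall>x\<in>S. iterated_deriv f ds differentiable (at x))"

text \<open>Surfaces are given by parametrizations \<open>X\<close> on a domain \<open>D\<close> of the parameter plane
  \<open>real^2\<close>.\<close>

definition partial :: "2 \<Rightarrow> (real^2 \<Rightarrow> 'b::real_normed_vector) \<Rightarrow> real^2 \<Rightarrow> 'b" where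
  "partial i f u = frechet_derivative f (at u) (axis i 1)"

definition metric :: "(real^2 \<Rightarrow> real^3) \<Rightarrow> real^2 \<Rightarrow> real^2^2" where
  "metric X u = (\<chi> i j. mink (partial i X u) (partial j X u))"

text \<open>Non-degeneracy of the induced metric forces the differential of \<open>X\<close> to be injective, so
  \<open>X\<close> is automatically an immersion.\<close>

definition nondegenerate_surface :: "(real^2) set \<Rightarrow> (real^2 \<Rightarrow> real^3) \<Rightarrow> bool" where
  "nondegenerate_surface D X \<longleftrightarrow>
     open D \<and> connected D \<and> D \<noteq> {} \<and> smooth_on D X \<and>
     (\<forall>u\<in>D. \<forall>a. (\<forall>b. a \<bullet> (metric X u *v b) = 0) \<longrightarrow> a = 0)"

definition christoffel :: "(real^2 \<Rightarrow> real^3) \<Rightarrow> 2 \<Rightarrow> 2 \<Rightarrow> 2 \<Rightarrow> real^2 \<Rightarrow> real" where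
  "christoffel X k i j u =
     (\<Sum>l\<in>UNIV. matrix_inv (metric X u) $ k $ l *
        (partial i (\<lambda>u. metric X u $ j $ l) u + partial j (\<lambda>u. metric X u $ i $ l) u
          - partial l (\<lambda>u. metric X u $ i $ j) u)) / 2"

text \<open>The components \<open>\<sigma>(X\<^sub>i, X\<^sub>j) = \<nabla>\<^sup>0 X\<^sub>j - \<nabla> X\<^sub>j\<close> (derivatives along \<open>X\<^sub>i\<close>) of the second
  fundamental form.  As \<open>E\<^sub>1\<^sup>3\<close> is flat, \<open>\<nabla>\<^sup>0 X\<^sub>j\<close> is the ordinary second partial derivative of
  \<open>X\<close>; the Levi-Civita connection \<open>\<nabla>\<close> of the surface is given by the Christoffel symbols of
  the induced metric.\<close>

definition second_fundamental_form ::
    "(real^2 \<Rightarrow> real^3) \<Rightarrow> 2 \<Rightarrow> 2 \<Rightarrow> real^2 \<Rightarrow> real^3" where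
  "second_fundamental_form X i j u =
     partial i (partial j X) u - (\<Sum>k\<in>UNIV. christoffel X k i j u *\<^sub>R partial k X u)"

definition mean_curvature_vector :: "(real^2 \<Rightarrow> real^3) \<Rightarrow> real^2 \<Rightarrow> real^3" where
  "mean_curvature_vector X u =
     (1/2) *\<^sub>R (\<Sum>i\<in>UNIV. \<Sum>j\<in>UNIV.
        matrix_inv (metric X u) $ i $ j *\<^sub>R second_fundamental_form X i j u)"

definition unit_normal_field ::
    "(real^2) set \<Rightarrow> (real^2 \<Rightarrow> real^3) \<Rightarrow> (real^2 \<Rightarrow> real^3) \<Rightarrow> bool" where
  "unit_normal_field D X N \<longleftrightarrow>
     continuous_on D N \<and>
     (\<forall>u\<in>D. \<bar>mink (N u) (N u)\<bar> = 1 \<and> (\<forall>i. mink (N u) (partial i X u) = 0))"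

definition mean_curvature :: "(real^2 \<Rightarrow> real^3) \<Rightarrow> (real^2 \<Rightarrow> real^3) \<Rightarrow> real^2 \<Rightarrow> real" where
  "mean_curvature X N u = (THE H. mean_curvature_vector X u = H *\<^sub>R N u)"

definition translating_soliton ::
    "(real^2) set \<Rightarrow> (real^2 \<Rightarrow> real^3) \<Rightarrow> (real^2 \<Rightarrow> real^3) \<Rightarrow> real^3 \<Rightarrow> bool" where
  "translating_soliton D X N v \<longleftrightarrow>
     nondegenerate_surface D X \<and> unit_normal_field D X N \<and>
     (\<forall>u\<in>D. 2 * mean_curvature X N u = mink (N u) v)"

text \<open>Ruled surfaces; the parameter pair \<open>(s, t)\<close> is \<open>(u $ 1, u $ 2)\<close>.\<close>

definition ruled :: "(real \<Rightarrow> real^3) \<Rightarrow> (real \<Rightarrow> real^3) \<Rightarrow> real^2 \<Rightarrow> real^3" where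
  "ruled \<gamma> w u = \<gamma> (u $ 1) + u $ 2 *\<^sub>R w (u $ 1)"

definition regular_curve :: "real set \<Rightarrow> (real \<Rightarrow> real^3) \<Rightarrow> bool" where
  "regular_curve I \<gamma> \<longleftrightarrow> smooth_on I \<gamma> \<and> (\<forall>s\<in>I. vector_derivative \<gamma> (at s) \<noteq> 0)"

definition cylindrical :: "real set \<Rightarrow> (real \<Rightarrow> real^3) \<Rightarrow> bool" where
  "cylindrical I w \<longleftrightarrow> (\<exists>d. d \<noteq> 0 \<and> (\<forall>s\<in>I. \<exists>c. w s = c *\<^sub>R d))"

definition ruling :: "real \<Rightarrow> real^3" where
  "ruling s = vector [1, s, s]"

definition avec :: "real^3" where
  "avec = vector [0, 1, 1]"

text \<open>\<open>\<gamma> + h w\<close> parametrizes the same ruled surface as \<open>\<gamma>\<close>, via \<open>(s, t) \<mapsto> (s, t + h s)\<close>.  It is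
  the base curve normalized by orthogonality to the rulings, which makes \<open>h\<close> unique up to an
  additive constant.\<close>

definition orthogonal_shift ::
    "real set \<Rightarrow> (real \<Rightarrow> real^3) \<Rightarrow> (real \<Rightarrow> real^3) \<Rightarrow> (real \<Rightarrow> real) \<Rightarrow> bool" where
  "orthogonal_shift I \<gamma> w h \<longleftrightarrow>
     smooth_on I h \<and>
     (\<forall>s\<in>I. mink (vector_derivative (\<lambda>s. \<gamma> s + h s *\<^sub>R w s) (at s)) (w s) = 0)"

text \<open>The real \<open>ln\<close> satisfies \<open>ln (- x) = ln x\<close>, so \<open>ln x\<close> is \<open>log |x|\<close> for \<open>x \<noteq> 0\<close>, and
  \<open>artanh x = ln ((1 + x) / (1 - x)) / 2\<close> is also an antiderivative of \<open>1 / (1 - x\<^sup>2)\<close> for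
  \<open>|x| > 1\<close>.  Both are used in this extended sense.\<close>

definition base_curve_form ::
    "real set \<Rightarrow> (real \<Rightarrow> real^3) \<Rightarrow>
     (real \<Rightarrow> real) \<Rightarrow> (real \<Rightarrow> real) \<Rightarrow> (real \<Rightarrow> real) \<Rightarrow> bool" where
  "base_curve_form I \<beta> \<Phi> x z \<longleftrightarrow> (\<forall>s\<in>I. \<beta> s = vector [x s, z s + \<Phi> s, z s])"

end

theory Submission
  imports Defs
begin

text \<open>Write \<open>w s = (1, s, s)\<close> for the ruling and \<open>a = (0, 1, 1) = w'\<close>.  Along
  \<open>X(s, t) = \<gamma> s + t w s\<close> the tangent vectors are \<open>P = \<gamma>' + t a\<close> and \<open>w\<close>, with \<open>\<langle>w, w\<rangle> = 1\<close>
  and \<open>\<langle>w, a\<rangle> = \<langle>a, a\<rangle> = 0\<close>.  The unit normal is a multiple of the Lorentzian cross product of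
  \<open>P\<close> and \<open>w\<close>, and this multiple cancels in the soliton equation, which becomes
  \<open>\<epsilon> (det(P, w, \<gamma>'') - 2 \<langle>P, w\<rangle> det(P, w, a)) = (\<langle>P, P\<rangle> - \<langle>P, w\<rangle>^2) det(P, w, v)\<close>.
  Both sides are polynomials in \<open>t\<close> of degree at most two, valid on an open set of \<open>t\<close> for
  every \<open>s\<close>, so their coefficients agree.

  Put \<open>q = \<langle>\<gamma>', a\<rangle>\<close>.  If \<open>q\<close> vanished at some \<open>s\<close>, then \<open>\<gamma>'\<close> would lie in the plane of \<open>w\<close>
  and \<open>a\<close>, on which the metric is degenerate; hence \<open>q \<noteq> 0\<close>.  The coefficient of \<open>t^2\<close> is a
  multiple of \<open>q \<langle>a, v\<rangle>\<close>, so \<open>\<langle>a, v\<rangle> = 0\<close> and \<open>v = (v1, v3, v3)\<close>.  The coefficient of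
  \<open>t\<close> is the equation \<open>\<epsilon> q' = 2 q^2 (s v1 - v3)\<close>, and the constant term, divided by \<open>q\<close>,
  determines \<open>\<gamma>3''\<close>.  These facts are \<open>soliton_profile_equations\<close>.

  Everything can now be integrated.  The equation for \<open>q\<close> says that \<open>1 / q\<close> is a quadratic
  polynomial in \<open>s\<close> with one free constant (\<open>reciprocal_antiderivative\<close>).  For the base curve
  \<open>(x, z + \<Phi>, z)\<close> orthogonal to the rulings one has \<open>\<Phi>' = q\<close>, \<open>x' = - s q\<close>, and the equation for
  \<open>\<gamma>3''\<close> has the first integral \<open>z' = - (s^2 + 1) q / 2 + b\<close>
  (\<open>soliton_profile_of_orthogonal_base_curve\<close>).  Thus \<open>q\<close> determines the curve up to a
  translation and the constant \<open>b\<close> (\<open>soliton_profile_base_curve_form\<close>).  Dilating by \<open>v3\<close> or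
  \<open>v1\<close> normalizes \<open>v\<close>; then \<open>1 / q\<close> is affine in \<open>s\<close> if \<open>v1 = 0\<close>, and otherwise it is
  \<open>- (a + \<epsilon> (s - v2)^2)\<close> with a constant \<open>a\<close>, which has a double root, no real root or two real
  roots according to the sign of \<open>a \<epsilon>\<close>.  The corresponding antiderivatives are the logarithm, a
  rational function, the arctangent and the extended \<open>artanh\<close>.\<close>

section \<open>Smooth functions of one real variable\<close>

lemma iterated_deriv_has_vector_derivative:
  fixes f :: "real \<Rightarrow> 'b::real_normed_vector"
  assumes "smooth_on I f" "s \<in> I"
  shows "(iterated_deriv f (replicate n 1) has_vector_derivative
           iterated_deriv f (replicate (Suc n) 1) s) (at s)"
proof -
  let ?g = "iterated_deriv f (replicate n 1)"
  have "?g differentiable (at s)"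
    using assms by (auto simp: smooth_on_def)
  then have d: "(?g has_derivative frechet_derivative ?g (at s)) (at s)"
    by (simp add: frechet_derivative_works)
  have "frechet_derivative ?g (at s) r = r *\<^sub>R frechet_derivative ?g (at s) 1" for r
    using linear_scale[OF has_derivative_linear[OF d], of r 1] by simp
  then have "frechet_derivative ?g (at s) = (\<lambda>r. r *\<^sub>R frechet_derivative ?g (at s) 1)"
    by blast
  with d show ?thesis
    by (simp add: has_vector_derivative_def)
qed

text \<open>In dimension one, an iterated directional derivative along a list of directions is the
  derivative of order the length of the list, times the product of the directions.  Hence a whole
  sequence of successive derivatives certifies smoothness.\<close>

lemma smooth_on_derivative_sequence:
  fixes g :: "nat \<Rightarrow> real \<Rightarrow> 'b::real_normed_vector"
  assumes "open I"
    and deriv: "\<And>n s. s \<in> I \<Longrightarrow> (g n has_vector_derivative g (Suc n) s) (at s)"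
  shows "smooth_on I (g 0)"
proof -
  have *: "(iterated_deriv (g 0) ds has_vector_derivative
             prod_list ds *\<^sub>R g (Suc (length ds)) s) (at s)
           \<and> iterated_deriv (g 0) ds s = prod_list ds *\<^sub>R g (length ds) s"
    if "s \<in> I" for ds s
    using that
  proof (induction ds arbitrary: s)
    case Nil
    then show ?case using deriv by simp
  next
    case (Cons d ds)
    have eq: "iterated_deriv (g 0) (d # ds) r = prod_list (d # ds) *\<^sub>R g (length (d # ds)) r"
      if "r \<in> I" for r
      using frechet_derivative_at[OF Cons.IH[OF that, THEN conjunct1, unfolded has_vector_derivative_def], symmetric]
      by simp
    have "((\<lambda>r. prod_list (d # ds) *\<^sub>R g (length (d # ds)) r) has_vector_derivative
             prod_list (d # ds) *\<^sub>R g (Suc (length (d # ds))) s) (at s)"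
      using bounded_linear.has_vector_derivative[OF bounded_linear_scaleR_right deriv[OF Cons.prems]] .
    then have "(iterated_deriv (g 0) (d # ds) has_vector_derivative
             prod_list (d # ds) *\<^sub>R g (Suc (length (d # ds))) s) (at s)"
      by (rule has_vector_derivative_transform_within_open[OF _ \<open>open I\<close> Cons.prems])
        (simp only: eq)
    then show ?case using eq[OF Cons.prems] by blast
  qed
  then show ?thesis
    unfolding smooth_on_def differentiable_def has_vector_derivative_def by blast
qed

lemma antiderivative_on_open_interval:
  fixes f :: "real \<Rightarrow> real"
  assumes "open I" "connected I" "continuous_on I f"
  shows "\<exists>F. \<forall>s\<in>I. (F has_vector_derivative f s) (at s)"
proof (cases "I = {}")
  case False
  then obtain c where "c \<in> I" by blast
  show ?thesis
  proof (intro exI ballI)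
    fix s assume "s \<in> I"
    have "min c s \<in> I" "max c s \<in> I" using \<open>c \<in> I\<close> \<open>s \<in> I\<close> by (auto simp: min_def max_def)
    obtain d where d: "d > 0" "cball (min c s) d \<subseteq> I"
      using \<open>open I\<close> \<open>min c s \<in> I\<close> by (meson open_contains_cball)
    obtain e where e: "e > 0" "cball (max c s) e \<subseteq> I"
      using \<open>open I\<close> \<open>max c s \<in> I\<close> by (meson open_contains_cball)
    let ?a = "min c s - d" and ?b = "max c s + e"
    have "?a \<in> I" "?b \<in> I" using d e by (auto simp: subset_iff dist_real_def)
    then have sub: "{?a..?b} \<subseteq> I"
      using \<open>connected I\<close> by (meson connected_contains_Icc)
    have "((\<lambda>u. LBINT y=c..u. f y) has_vector_derivative f s) (at s within {?a..?b})"
      by (rule interval_integral_FTC2)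
        (use d e sub assms(3) in \<open>auto intro: continuous_on_subset\<close>)
    then have "((\<lambda>u. LBINT y=c..u. f y) has_vector_derivative f s) (at s within {?a<..<?b})"
      by (rule has_vector_derivative_within_subset) auto
    then show "((\<lambda>u. LBINT y=c..u. f y) has_vector_derivative f s) (at s)"
      using d e by (subst (asm) has_vector_derivative_within_open) auto
  qed
qed auto

lemma equal_derivatives_differ_by_constant:
  fixes f g :: "real \<Rightarrow> real"
  assumes "convex I"
    and "\<And>s. s \<in> I \<Longrightarrow> (f has_real_derivative f' s) (at s)"
    and "\<And>s. s \<in> I \<Longrightarrow> (g has_real_derivative f' s) (at s)"
  shows "\<exists>c. \<forall>s\<in>I. g s = f s + c"
proof -
  have "((\<lambda>s. g s - f s) has_field_derivative 0) (at s within I)" if "s \<in> I" for s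
    using DERIV_diff[OF assms(3)[OF that] assms(2)[OF that]]
    by (simp add: has_field_derivative_at_within)
  then obtain c where "\<forall>s\<in>I. g s - f s = c"
    using has_field_derivative_zero_constant[OF assms(1)] by blast
  then show ?thesis by (intro exI[of _ c]) (auto simp: algebra_simps)
qed

section \<open>Mean curvature in Minkowski space\<close>

lemma mink_bounded_bilinear: "bounded_bilinear mink"
  unfolding bilinear_conv_bounded_bilinear[symmetric] bilinear_def linear_iff mink_def
  by (simp add: algebra_simps)

interpretation mink: bounded_bilinear mink by (rule mink_bounded_bilinear)

lemma mink_commute: "mink p q = mink q p"
  by (simp add: mink_def mult.commute)

lemma partial_iterated_deriv: "partial i f = iterated_deriv f [axis i 1]"
  by (auto simp: partial_def[abs_def])

lemma partial_mink:
  assumes "f differentiable (at u)" "g differentiable (at u)"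
  shows "partial i (\<lambda>u. mink (f u) (g u)) u = mink (partial i f u) (g u) + mink (f u) (partial i g u)"
proof -
  have "((\<lambda>u. mink (f u) (g u)) has_derivative
    (\<lambda>h. mink (f u) (frechet_derivative g (at u) h) + mink (frechet_derivative f (at u) h) (g u))) (at u)"
    using assms by (intro mink.FDERIV) (simp_all add: frechet_derivative_works)
  then show ?thesis
    by (simp add: partial_def frechet_derivative_at[symmetric])
qed

lemma metric_symmetric: "metric X u $ i $ j = metric X u $ j $ i"
  by (simp add: metric_def mink_commute)

lemma metric_inverse:
  assumes "nondegenerate_surface D X" "u \<in> D"
  shows "metric X u ** matrix_inv (metric X u) = mat 1" "matrix_inv (metric X u) ** metric X u = mat 1"
proof -
  let ?g = "metric X u"
  have "a = 0" if "?g *v a = 0" for a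
  proof -
    have "transpose ?g = ?g"
      by (simp add: transpose_def vec_eq_iff metric_symmetric[of X u])
    then have "a v* ?g = 0"
      using that by (metis vector_transpose_matrix)
    then have "\<forall>b. a \<bullet> (?g *v b) = 0"
      by (metis dot_lmul_matrix inner_zero_left)
    then show ?thesis
      using assms unfolding nondegenerate_surface_def by blast
  qed
  then have "invertible ?g"
    by (simp add: invertible_left_inverse matrix_left_invertible_ker)
  then have "\<exists>B. ?g ** B = mat 1 \<and> B ** ?g = mat 1"
    by (simp add: invertible_def)
  then have "?g ** matrix_inv ?g = mat 1 \<and> matrix_inv ?g ** ?g = mat 1"
    unfolding matrix_inv_def by (rule someI_ex)
  then show "?g ** matrix_inv ?g = mat 1" "matrix_inv ?g ** ?g = mat 1" by auto
qed

text \<open>The Christoffel symbols are those of the Levi-Civita connection: because second partial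
  derivatives commute, the Koszul formula applied to the induced metric returns the inner products
  \<open>\<langle>X\<^sub>i\<^sub>j, X\<^sub>m\<rangle>\<close>.  So the Christoffel terms subtract exactly the tangential part of \<open>X\<^sub>i\<^sub>j\<close>.\<close>

lemma second_fundamental_form_normal:
  assumes nd: "nondegenerate_surface D X" and u: "u \<in> D"
    and sym: "\<And>i j. partial i (partial j X) u = partial j (partial i X) u"
  shows "mink (second_fundamental_form X i j u) (partial m X u) = 0"
proof -
  have diff: "partial j X differentiable (at u)" for j
    using nd u unfolding partial_iterated_deriv nondegenerate_surface_def smooth_on_def by blast
  have "partial i (\<lambda>u. metric X u $ j $ l) u =
      mink (partial i (partial j X) u) (partial l X u) + mink (partial j X u) (partial i (partial l X) u)"
    for i j l
    using partial_mink[OF diff diff] by (simp add: metric_def)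
  then have koszul: "partial i (\<lambda>u. metric X u $ j $ l) u + partial j (\<lambda>u. metric X u $ i $ l) u
          - partial l (\<lambda>u. metric X u $ i $ j) u = 2 * mink (partial i (partial j X) u) (partial l X u)" for l
    using sym[of i j] sym[of i l] sym[of j l] by (simp add: mink_commute)
  have "(\<Sum>k\<in>UNIV. christoffel X k i j u * metric X u $ k $ m) =
    (\<Sum>k\<in>UNIV. \<Sum>l\<in>UNIV. metric X u $ m $ k * matrix_inv (metric X u) $ k $ l * mink (partial i (partial j X) u) (partial l X u))"
    unfolding christoffel_def koszul
    by (intro sum.cong refl)
      (simp add: sum_distrib_right sum_distrib_left sum_divide_distrib metric_symmetric[of X u m] mult_ac)
  also have "\<dots> = (\<Sum>l\<in>UNIV. (metric X u ** matrix_inv (metric X u)) $ m $ l * mink (partial i (partial j X) u) (partial l X u))"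
    by (subst sum.swap) (simp add: matrix_matrix_mult_def sum_distrib_right)
  also have "\<dots> = mink (partial i (partial j X) u) (partial m X u)"
    unfolding metric_inverse(1)[OF nd u] by (simp add: mat_def if_distrib[of "\<lambda>x. x * _"] cong: if_cong)
  finally show ?thesis
    by (simp add: second_fundamental_form_def mink.diff_left mink.sum_left mink.scaleR_left metric_def)
qed

lemma mink_Lagrange:
  "mink p p * mink q q - (mink p q)\<^sup>2 = - mink (cross3 p q) (cross3 p q)"
  by (simp add: mink_def cross_components) algebra

text \<open>A vector orthogonal to \<open>p\<close> and \<open>q\<close> for the Minkowski product becomes orthogonal for the
  Euclidean one once its third coordinate changes sign, and is then a multiple of the Euclidean cross
  product.\<close>

lemma mink_orthogonal_pair:
  assumes "cross3 p q \<noteq> 0" "mink m p = 0" "mink m q = 0"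
  obtains \<kappa> where "m $ 1 = \<kappa> * cross3 p q $ 1" "m $ 2 = \<kappa> * cross3 p q $ 2"
    "m $ 3 = - \<kappa> * cross3 p q $ 3"
proof -
  define m' :: "real^3" where "m' = vector [m $ 1, m $ 2, - m $ 3]"
  have m': "m' \<bullet> z = mink m z" for z
    by (simp add: m'_def mink_def inner_vec_def sum_3)
  \<comment> \<open>By the Lagrange identity \<open>m'\<close> is parallel to the cross product.\<close>
  have "cross3 (cross3 p q) m' = - cross3 m' (cross3 p q)"
    by (rule cross_skew)
  also have "\<dots> = 0"
    using assms(2,3) by (simp add: Lagrange m')
  finally obtain \<kappa> where "m' = \<kappa> *\<^sub>R cross3 p q"
    using assms(1) by (auto simp: cross_eq_0 collinear_lemma)
  then have "m' $ i = \<kappa> * cross3 p q $ i" for i by simp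
  from this[of 1] this[of 2] this[of 3] show ?thesis
    by (intro that) (auto simp: m'_def)
qed

lemma metric_det_nonzero:
  assumes "nondegenerate_surface D X" "u \<in> D"
  shows "mink (partial 1 X u) (partial 1 X u) * mink (partial 2 X u) (partial 2 X u)
           - (mink (partial 1 X u) (partial 2 X u))\<^sup>2 \<noteq> 0"
proof -
  have "invertible (metric X u)"
    using metric_inverse[OF assms] by (auto simp: invertible_def)
  then have "det (metric X u) \<noteq> 0"
    by (simp add: invertible_det_nz)
  then show ?thesis
    by (simp add: det_2 metric_def mink_commute power2_eq_square)
qed

text \<open>Paired with a normal vector the tangential corrections disappear, so the trace only sees
  the second derivatives of \<open>X\<close>.  Multiplying by the determinant of the metric replaces the inverse
  metric by its adjugate.\<close>

lemma mean_curvature_vector_trace: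
  assumes nd: "nondegenerate_surface D X" and u: "u \<in> D"
    and sym: "\<And>i j. partial i (partial j X) u = partial j (partial i X) u"
    and n: "\<And>i. mink n (partial i X u) = 0"
  defines "E \<equiv> mink (partial 1 X u) (partial 1 X u)"
    and "F \<equiv> mink (partial 1 X u) (partial 2 X u)"
    and "G \<equiv> mink (partial 2 X u) (partial 2 X u)"
  shows "2 * (E * G - F\<^sup>2) * mink n (mean_curvature_vector X u) =
    G * mink n (partial 1 (partial 1 X) u) - 2 * F * mink n (partial 1 (partial 2 X) u)
      + E * mink n (partial 2 (partial 2 X) u)"
proof -
  define B where "B = matrix_inv (metric X u)"
  define W where "W = E * G - F\<^sup>2"
  have g: "metric X u $ 1 $ 1 = E" "metric X u $ 1 $ 2 = F" "metric X u $ 2 $ 1 = F" "metric X u $ 2 $ 2 = G"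
    by (simp_all add: metric_def E_def F_def G_def mink_commute)
  have BA: "(B ** metric X u) $ i $ j = mat 1 $ i $ j" for i j
    by (simp add: B_def metric_inverse(2)[OF nd u])
  have eqs: "B $ 1 $ 1 * E + B $ 1 $ 2 * F = 1" "B $ 1 $ 1 * F + B $ 1 $ 2 * G = 0"
    "B $ 2 $ 1 * E + B $ 2 $ 2 * F = 0" "B $ 2 $ 1 * F + B $ 2 $ 2 * G = 1"
    using BA[of 1 1] BA[of 1 2] BA[of 2 1] BA[of 2 2]
    by (simp_all add: matrix_matrix_mult_def sum_2 g mat_def)
  have inv: "W * B $ 1 $ 1 = G" "W * B $ 1 $ 2 = - F" "W * B $ 2 $ 1 = - F" "W * B $ 2 $ 2 = E"
    using eqs unfolding W_def by algebra+
  have "mink n (second_fundamental_form X i j u) = mink n (partial i (partial j X) u)" for i j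
    by (simp add: second_fundamental_form_def mink.diff_right mink.sum_right mink.scaleR_right n)
  then have "2 * mink n (mean_curvature_vector X u) =
      (\<Sum>i\<in>UNIV. \<Sum>j\<in>UNIV. B $ i $ j * mink n (partial i (partial j X) u))"
    by (simp add: mean_curvature_vector_def mink.sum_right mink.scaleR_right B_def)
  then have "2 * W * mink n (mean_curvature_vector X u) =
     W * B $ 1 $ 1 * mink n (partial 1 (partial 1 X) u) + W * B $ 1 $ 2 * mink n (partial 1 (partial 2 X) u)
     + W * B $ 2 $ 1 * mink n (partial 1 (partial 2 X) u) + W * B $ 2 $ 2 * mink n (partial 2 (partial 2 X) u)"
    using sym[of 2 1] by (simp add: sum_2 algebra_simps)
  then show ?thesis
    unfolding inv by (simp add: W_def)
qed

text \<open>The normal is a multiple \<open>\<kappa>\<close> of the Lorentzian cross product.  Pairing \<open>H N\<close> with \<open>N\<close>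
  isolates \<open>H \<langle>N, N\<rangle>\<close>; what remains is linear in \<open>N\<close> on both sides, so \<open>\<kappa>\<close>, and with it the
  length and orientation of the cross product, cancels.\<close>

lemma translating_soliton_equation:
  assumes sol: "translating_soliton D X N v" and u: "u \<in> D"
    and sym: "\<And>i j. partial i (partial j X) u = partial j (partial i X) u"
  defines "E \<equiv> mink (partial 1 X u) (partial 1 X u)"
    and "F \<equiv> mink (partial 1 X u) (partial 2 X u)"
    and "G \<equiv> mink (partial 2 X u) (partial 2 X u)"
    and "c \<equiv> cross3 (partial 1 X u) (partial 2 X u)"
  shows "mink (N u) (N u) * (E * G - F\<^sup>2) * (c \<bullet> v) =
    G * (c \<bullet> partial 1 (partial 1 X) u) - 2 * F * (c \<bullet> partial 1 (partial 2 X) u)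
      + E * (c \<bullet> partial 2 (partial 2 X) u)"
proof -
  have nd: "nondegenerate_surface D X"
    and unit: "\<bar>mink (N u) (N u)\<bar> = 1" and orth: "\<And>i. mink (N u) (partial i X u) = 0"
    and H: "2 * mean_curvature X N u = mink (N u) v"
    using sol u by (auto simp: translating_soliton_def unit_normal_field_def)
  let ?H = "mean_curvature_vector X u"
  have "E * G - F\<^sup>2 \<noteq> 0"
    unfolding E_def F_def G_def by (rule metric_det_nonzero[OF nd u])
  then have c0: "c \<noteq> 0"
    using mink_Lagrange[of "partial 1 X u" "partial 2 X u"]
    by (auto simp: E_def F_def G_def c_def mink_def)
  obtain \<kappa> where \<kappa>: "N u $ 1 = \<kappa> * c $ 1" "N u $ 2 = \<kappa> * c $ 2" "N u $ 3 = - \<kappa> * c $ 3"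
    using mink_orthogonal_pair[OF c0[unfolded c_def] orth orth] unfolding c_def by blast
  have N: "mink (N u) z = \<kappa> * (c \<bullet> z)" for z
    by (simp add: mink_def \<kappa> inner_vec_def sum_3 algebra_simps)
  have "\<kappa> \<noteq> 0"
    using unit N by force
  have "mink ?H (partial l X u) = 0" for l
    by (simp add: mean_curvature_vector_def mink.sum_left mink.scaleR_left
        second_fundamental_form_normal[OF nd u sym])
  then obtain \<kappa>' where \<kappa>': "?H $ 1 = \<kappa>' * c $ 1" "?H $ 2 = \<kappa>' * c $ 2" "?H $ 3 = - \<kappa>' * c $ 3"
    using mink_orthogonal_pair[OF c0[unfolded c_def]] unfolding c_def by blast
  \<comment> \<open>The mean curvature vector is normal too, hence a multiple of \<open>N\<close>; this determines the mean curvature.\<close>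
  have HN: "?H = (\<kappa>' / \<kappa>) *\<^sub>R N u"
    using \<open>\<kappa> \<noteq> 0\<close> by (simp add: vec_eq_iff forall_3 \<kappa> \<kappa>')
  have "N u \<noteq> 0"
    using unit by (auto simp: mink.zero_left)
  then have "mean_curvature X N u = \<kappa>' / \<kappa>"
    unfolding mean_curvature_def HN by (intro the_equality) auto
  then have "2 * mink (N u) ?H = mink (N u) (N u) * mink (N u) v"
    unfolding H[symmetric] HN by (simp add: mink.scaleR_right)
  then have "\<kappa> * (mink (N u) (N u) * (E * G - F\<^sup>2) * (c \<bullet> v)) =
     (E * G - F\<^sup>2) * (2 * mink (N u) ?H)"
    unfolding N[of v] by (simp add: mult_ac)
  also have "\<dots> = \<kappa> * (G * (c \<bullet> partial 1 (partial 1 X) u) - 2 * F * (c \<bullet> partial 1 (partial 2 X) u)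
      + E * (c \<bullet> partial 2 (partial 2 X) u))"
    using mean_curvature_vector_trace[OF nd u sym orth]
    by (simp add: E_def F_def G_def N algebra_simps)
  finally show ?thesis
    using \<open>\<kappa> \<noteq> 0\<close> by simp
qed

text \<open>On a connected domain the continuous function \<open>\<langle>N, N\<rangle>\<close> with values in \<open>{-1, 1}\<close> is
  constant, which provides a single \<open>\<epsilon>\<close> for the whole surface.\<close>

lemma unit_normal_field_causal_character:
  assumes "connected D" "unit_normal_field D X N"
  shows "\<exists>\<epsilon>\<in>{-1, 1}. \<forall>u\<in>D. mink (N u) (N u) = \<epsilon>"
proof -
  let ?f = "\<lambda>u. mink (N u) (N u)"
  have "continuous_on D ?f"
    using assms(2) by (auto simp: unit_normal_field_def intro!: mink.continuous_on)
  moreover have fin: "?f ` D \<subseteq> {-1, 1}"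
    using assms(2) by (auto simp: unit_normal_field_def abs_if split: if_splits)
  moreover have "finite {-1, 1 :: real}" by simp
  ultimately have "?f constant_on D"
    using assms(1) by (metis continuous_finite_range_constant finite_subset)
  then show ?thesis
    using fin by (cases "D = {}") (fastforce simp: constant_on_def)+
qed

section \<open>The soliton equation along the rulings\<close>

lemma ruling_nth [simp]: "ruling s $ 1 = 1" "ruling s $ 2 = s" "ruling s $ 3 = s"
  by (simp_all add: ruling_def)

lemma avec_nth [simp]: "avec $ 1 = 0" "avec $ 2 = 1" "avec $ 3 = 1"
  by (simp_all add: avec_def)

lemma ruling_has_vector_derivative: "(ruling has_vector_derivative avec) (at s)"
proof -
  have "((\<lambda>s. ruling 0 + s *\<^sub>R avec) has_vector_derivative avec) (at s)"
    by (auto intro!: derivative_eq_intros)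
  moreover have "ruling = (\<lambda>s. ruling 0 + s *\<^sub>R avec)"
    by (simp add: fun_eq_iff vec_eq_iff forall_3)
  ultimately show ?thesis by simp
qed

lemma has_derivative_compose_nth:
  assumes "(f has_vector_derivative f') (at (u $ i))"
  shows "((\<lambda>u :: real^'n. f (u $ i)) has_derivative (\<lambda>d. d $ i *\<^sub>R f')) (at u)"
  using has_derivative_compose[OF bounded_linear.has_derivative[OF bounded_linear_vec_nth has_derivative_ident], of f]
    assms by (simp add: has_vector_derivative_def)

text \<open>The formulas for the first derivatives hold on the open strip over \<open>I\<close>, which is what
  allows differentiating them once more.\<close>

lemma ruled_partials:
  assumes "open I"
    and d1: "\<And>s. s \<in> I \<Longrightarrow> (\<gamma> has_vector_derivative \<gamma>1 s) (at s)"
    and d2: "\<And>s. s \<in> I \<Longrightarrow> (\<gamma>1 has_vector_derivative \<gamma>2 s) (at s)"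
    and u: "u $ 1 \<in> I"
  defines "X \<equiv> ruled \<gamma> ruling"
  shows "partial 1 X u = \<gamma>1 (u $ 1) + u $ 2 *\<^sub>R avec" "partial 2 X u = ruling (u $ 1)"
    "partial 1 (partial 1 X) u = \<gamma>2 (u $ 1)" "partial 1 (partial 2 X) u = avec"
    "partial 2 (partial 1 X) u = avec" "partial 2 (partial 2 X) u = 0"
proof -
  let ?S = "(\<lambda>u. u $ 1) -` I :: (real^2) set"
  have S: "open ?S" by (rule open_vimage_vec_nth[OF \<open>open I\<close>])
  have eqs: "partial 1 X u = \<gamma>1 (u $ 1) + u $ 2 *\<^sub>R avec" "partial 2 X u = ruling (u $ 1)"
    if "u \<in> ?S" for u
  proof -
    have "(X has_derivative (\<lambda>d. d $ 1 *\<^sub>R \<gamma>1 (u $ 1) + (d $ 2 *\<^sub>R ruling (u $ 1) + u $ 2 *\<^sub>R d $ 1 *\<^sub>R avec))) (at u)"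
      unfolding X_def ruled_def[abs_def] using that
      by (auto intro!: derivative_eq_intros has_derivative_compose_nth ruling_has_vector_derivative d1
          bounded_linear_imp_has_derivative bounded_linear_vec_nth)
    from frechet_derivative_at[OF this, symmetric]
    show "partial 1 X u = \<gamma>1 (u $ 1) + u $ 2 *\<^sub>R avec" "partial 2 X u = ruling (u $ 1)"
      by (simp_all add: partial_def axis_def)
  qed
  have uS: "u \<in> ?S" using u by simp
  show "partial 1 X u = \<gamma>1 (u $ 1) + u $ 2 *\<^sub>R avec" "partial 2 X u = ruling (u $ 1)"
    using eqs[OF uS] by auto
  have "((\<lambda>u. \<gamma>1 (u $ 1) + u $ 2 *\<^sub>R avec) has_derivative (\<lambda>d. d $ 1 *\<^sub>R \<gamma>2 (u $ 1) + d $ 2 *\<^sub>R avec)) (at u)"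
    using u by (auto intro!: derivative_eq_intros has_derivative_compose_nth d2
          bounded_linear_imp_has_derivative bounded_linear_vec_nth)
  then have "(partial 1 X has_derivative (\<lambda>d. d $ 1 *\<^sub>R \<gamma>2 (u $ 1) + d $ 2 *\<^sub>R avec)) (at u)"
    by (rule has_derivative_transform_within_open[OF _ S uS]) (simp add: eqs)
  from frechet_derivative_at[OF this, symmetric]
  show "partial 1 (partial 1 X) u = \<gamma>2 (u $ 1)" "partial 2 (partial 1 X) u = avec"
    by (simp_all add: partial_def[where f = "partial 1 X"] axis_def)
  have "((\<lambda>u. ruling (u $ 1)) has_derivative (\<lambda>d. d $ 1 *\<^sub>R avec)) (at u)"
    by (intro has_derivative_compose_nth ruling_has_vector_derivative)
  then have "(partial 2 X has_derivative (\<lambda>d. d $ 1 *\<^sub>R avec)) (at u)"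
    by (rule has_derivative_transform_within_open[OF _ S uS]) (simp add: eqs)
  from frechet_derivative_at[OF this, symmetric]
  show "partial 1 (partial 2 X) u = avec" "partial 2 (partial 2 X) u = 0"
    by (simp_all add: partial_def[where f = "partial 2 X"] axis_def)
qed

lemma quadratic_vanishing_on_open_set:
  fixes A B C :: real
  assumes "open T" "T \<noteq> {}" and zero: "\<And>t. t \<in> T \<Longrightarrow> A + B * t + C * t\<^sup>2 = 0"
  shows "A = 0" "B = 0" "C = 0"
proof -
  obtain t e where "e > 0" and e: "cball t e \<subseteq> T"
    using assms(1,2) by (meson all_not_in_conv open_contains_cball)
  then have "t \<in> T" "t + e \<in> T" "t - e \<in> T"
    by (auto simp: subset_iff dist_real_def)
  from this[THEN zero] have z: "A + B * t + C * t\<^sup>2 = 0" "A + B * (t + e) + C * (t + e)\<^sup>2 = 0"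
    "A + B * (t - e) + C * (t - e)\<^sup>2 = 0" by auto
  then have "2 * C * e\<^sup>2 = 0" by algebra
  then show C: "C = 0" using \<open>e > 0\<close> by simp
  with z(1,2) have "B * e = 0" by algebra
  then show B: "B = 0" using \<open>e > 0\<close> by simp
  show "A = 0" using z(1) B C by simp
qed

lemma vector_derivative_components:
  fixes \<gamma> :: "real \<Rightarrow> real^3"
  assumes "(\<gamma> has_vector_derivative d) (at s)"
  shows "((\<lambda>s. \<gamma> s $ i) has_real_derivative d $ i) (at s)"
  using bounded_linear.has_vector_derivative[OF bounded_linear_vec_nth assms]
  by (simp add: has_real_derivative_iff_has_vector_derivative)

text \<open>Non-degeneracy gives \<open>q \<noteq> 0\<close>, and the three coefficients in \<open>t\<close> of the soliton equation
  along the ruling over \<open>s\<close> give the other three conclusions: the coefficient of \<open>t\<^sup>2\<close> the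
  orthogonality to \<open>v\<close>, that of \<open>t\<close> the equation for \<open>q'\<close>, and the constant term the one for
  the third coordinate.\<close>

lemma soliton_profile_equations:
  fixes \<gamma> :: "real \<Rightarrow> real^3"
  assumes "open D" "open I" and I: "I = (\<lambda>u. u $ 1) ` D"
    and d1: "\<And>s. s \<in> I \<Longrightarrow> (\<gamma> has_vector_derivative \<gamma>1 s) (at s)"
    and d2: "\<And>s. s \<in> I \<Longrightarrow> (\<gamma>1 has_vector_derivative \<gamma>2 s) (at s)"
    and sol: "translating_soliton D (ruled \<gamma> ruling) N v"
    and eps: "\<And>u. u \<in> D \<Longrightarrow> mink (N u) (N u) = \<epsilon>" and eps': "\<epsilon> \<in> {-1, 1}"
    and s: "s \<in> I"
  defines "q \<equiv> mink (\<gamma>1 s) avec" and "q' \<equiv> mink (\<gamma>2 s) avec"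
  shows "q \<noteq> 0" "mink avec v = 0"
    "\<epsilon> * q' = 2 * q\<^sup>2 * (s * v $ 1 - v $ 3)"
    "\<gamma>2 s $ 3 = s * \<gamma>2 s $ 1 + 2 * (\<gamma>1 s $ 1 + s * q) - (1 - s\<^sup>2) * q' / 2"
proof -
  let ?X = "ruled \<gamma> ruling"
  define p1 p2 p3 where "p1 = \<gamma>1 s $ 1" and "p2 = \<gamma>1 s $ 2" and "p3 = \<gamma>1 s $ 3"
  define r1 r2 r3 where "r1 = \<gamma>2 s $ 1" and "r2 = \<gamma>2 s $ 2" and "r3 = \<gamma>2 s $ 3"
  define v1 v2 v3 where "v1 = v $ 1" and "v2 = v $ 2" and "v3 = v $ 3"
  note comps = p1_def[symmetric] p2_def[symmetric] p3_def[symmetric] r1_def[symmetric] r2_def[symmetric]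
    r3_def[symmetric] v1_def[symmetric] v2_def[symmetric] v3_def[symmetric]
  have q: "q = p2 - p3" and q': "q' = r2 - r3"
    by (simp_all add: q_def q'_def mink_def comps)
  \<comment> \<open>The part of the ruling over \<open>s\<close> that lies in the domain.\<close>
  define T where "T = {t. vector [s, t] \<in> D}"
  have "T = (\<lambda>t. axis 1 s + t *\<^sub>R axis 2 1) -` D"
  proof -
    have "(vector [s, t] :: real^2) = axis 1 s + t *\<^sub>R axis 2 1" for t
      by (simp add: vec_eq_iff forall_2 axis_def)
    then show ?thesis by (auto simp: T_def)
  qed
  moreover have "continuous_on UNIV (\<lambda>t. axis 1 s + t *\<^sub>R axis 2 1 :: real^2)"
    by (intro continuous_intros)
  ultimately have "open T"
    using \<open>open D\<close> by (metis open_vimage)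
  obtain u where "u \<in> D" "u $ 1 = s" using s I by auto
  then have "vector [s, u $ 2] = u" by (simp add: vec_eq_iff forall_2)
  with \<open>u \<in> D\<close> have "u $ 2 \<in> T" by (simp add: T_def)
  then have "T \<noteq> {}" by blast
  have W: "p1\<^sup>2 + q * (p2 + p3) + 2 * t * q - (p1 + s * q)\<^sup>2 \<noteq> 0"
    and eq: "\<epsilon> * (p1\<^sup>2 + q * (p2 + p3) + 2 * t * q - (p1 + s * q)\<^sup>2) *
       ((s * v1 - v3) * q + (p3 + t - s * p1) * (v2 - v3)) =
       - s * p1 * q' + s * r1 * q + p3 * q' - q * r3 + t * q' + 2 * (p1 + s * q) * q"
    if "t \<in> T" for t
  proof -
    let ?u = "vector [s, t] :: real^2"
    have uD: "?u \<in> D" and uI: "?u $ 1 \<in> I" using that s by (simp_all add: T_def)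
    note partials = ruled_partials[OF \<open>open I\<close> d1 d2 uI, simplified]
    have nd: "nondegenerate_surface D ?X"
      using sol by (simp add: translating_soliton_def)
    have sym: "partial i (partial j ?X) ?u = partial j (partial i ?X) ?u" for i j
      using exhaust_2[of i] exhaust_2[of j] partials by auto
    have m: "mink (\<gamma>1 s + t *\<^sub>R avec) (\<gamma>1 s + t *\<^sub>R avec) = p1\<^sup>2 + q * (p2 + p3) + 2 * t * q"
      "mink (\<gamma>1 s + t *\<^sub>R avec) (ruling s) = p1 + s * q"
      "mink (ruling s) (ruling s) = 1"
      by (simp_all add: mink_def comps q power2_eq_square algebra_simps)
    have c: "cross3 (\<gamma>1 s + t *\<^sub>R avec) (ruling s) \<bullet> v = (s * v1 - v3) * q + (p3 + t - s * p1) * (v2 - v3)"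
      "cross3 (\<gamma>1 s + t *\<^sub>R avec) (ruling s) \<bullet> \<gamma>2 s = - s * p1 * q' + s * r1 * q + p3 * q' - q * r3 + t * q'"
      "cross3 (\<gamma>1 s + t *\<^sub>R avec) (ruling s) \<bullet> avec = - q"
      by (simp_all add: inner_vec_def sum_3 cross_components comps q q' algebra_simps)
    show "p1\<^sup>2 + q * (p2 + p3) + 2 * t * q - (p1 + s * q)\<^sup>2 \<noteq> 0"
      using metric_det_nonzero[OF nd uD] by (simp add: partials m)
    show "\<epsilon> * (p1\<^sup>2 + q * (p2 + p3) + 2 * t * q - (p1 + s * q)\<^sup>2) *
       ((s * v1 - v3) * q + (p3 + t - s * p1) * (v2 - v3)) =
       - s * p1 * q' + s * r1 * q + p3 * q' - q * r3 + t * q' + 2 * (p1 + s * q) * q"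
      using translating_soliton_equation[OF sol uD sym]
      by (simp add: partials m c eps[OF uD])
  qed
  \<comment> \<open>For \<open>q = 0\<close> the determinant of the metric would reduce to \<open>p1\<^sup>2 - p1\<^sup>2\<close>.\<close>
  show q0: "q \<noteq> 0"
    using W \<open>T \<noteq> {}\<close> by force
  \<comment> \<open>The soliton equation sorted by powers of \<open>t\<close>.\<close>
  have "(\<epsilon> * (p1\<^sup>2 + q * (p2 + p3) - (p1 + s * q)\<^sup>2) * ((s * v1 - v3) * q + (p3 - s * p1) * (v2 - v3))
       - (- s * p1 * q' + s * r1 * q + p3 * q' - q * r3 + 2 * (p1 + s * q) * q))
     + (\<epsilon> * (2 * q * ((s * v1 - v3) * q + (p3 - s * p1) * (v2 - v3))
           + (p1\<^sup>2 + q * (p2 + p3) - (p1 + s * q)\<^sup>2) * (v2 - v3)) - q') * t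
     + (\<epsilon> * 2 * q * (v2 - v3)) * t\<^sup>2 = 0" if "t \<in> T" for t
    using eq[OF that] by (simp add: algebra_simps power2_eq_square)
  note coeffs = quadratic_vanishing_on_open_set[OF \<open>open T\<close> \<open>T \<noteq> {}\<close> this]
  have v23: "v2 = v3"
    using coeffs(3) q0 eps' by auto
  then show "mink avec v = 0"
    by (simp add: mink_def comps)
  have ee: "\<epsilon> * \<epsilon> = 1" using eps' by auto
  have B: "q' = \<epsilon> * (2 * q\<^sup>2 * (s * v1 - v3))"
    using coeffs(2) v23 by (simp add: power2_eq_square algebra_simps)
  then have B': "\<epsilon> * q' = 2 * q\<^sup>2 * (s * v1 - v3)"
    using ee by (simp add: mult.assoc[symmetric])
  then show "\<epsilon> * q' = 2 * q\<^sup>2 * (s * v $ 1 - v $ 3)"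
    by (simp add: comps)
  have "\<epsilon> * (p1\<^sup>2 + q * (p2 + p3) - (p1 + s * q)\<^sup>2) * ((s * v1 - v3) * q) =
        - s * p1 * q' + s * r1 * q + p3 * q' - q * r3 + 2 * (p1 + s * q) * q"
    using coeffs(1) v23 by simp
  \<comment> \<open>Substituting the equation for \<open>q'\<close> cancels the terms with \<open>p3 q'\<close> and \<open>p1 q'\<close>.\<close>
  then have "q * (2 * r3) = q * (2 * s * r1 + 4 * (p1 + s * q) - (1 - s\<^sup>2) * q')"
    using B q ee by algebra
  then have "r3 = s * r1 + 2 * (p1 + s * q) - (1 - s\<^sup>2) * q' / 2"
    using q0 by simp
  then show "\<gamma>2 s $ 3 = s * \<gamma>2 s $ 1 + 2 * (\<gamma>1 s $ 1 + s * q) - (1 - s\<^sup>2) * q' / 2"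
    by (simp add: comps)
qed

section \<open>Curves determined by their profile function\<close>

text \<open>The differential equations satisfied by the components of an orthogonal base curve
  \<open>\<beta> = (x, z + \<Phi>, z)\<close> when \<open>f\<close> is the derivative of \<open>\<Phi>\<close>.  The first equation is orthogonality of
  \<open>\<beta>'\<close> to \<open>(1, s, s)\<close>; the last one is the first integral of the soliton equation.\<close>

definition soliton_profile :: "real set \<Rightarrow> (real \<Rightarrow> real^3) \<Rightarrow> (real \<Rightarrow> real) \<Rightarrow> bool" where
  "soliton_profile I \<beta> f \<longleftrightarrow> convex I \<and> (\<exists>b. \<forall>s\<in>I.
     ((\<lambda>s. \<beta> s $ 1) has_real_derivative - s * f s) (at s) \<and>
     ((\<lambda>s. \<beta> s $ 2 - \<beta> s $ 3) has_real_derivative f s) (at s) \<and>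
     ((\<lambda>s. \<beta> s $ 3) has_real_derivative - (s\<^sup>2 + 1) * f s / 2 + b) (at s))"

lemma soliton_profile_scaleR:
  assumes "soliton_profile I \<beta> f"
  shows "soliton_profile I (\<lambda>s. \<mu> *\<^sub>R \<beta> s) (\<lambda>s. \<mu> * f s)"
proof -
  obtain b where b: "\<And>s. s \<in> I \<Longrightarrow>
     ((\<lambda>s. \<beta> s $ 1) has_real_derivative - s * f s) (at s) \<and>
     ((\<lambda>s. \<beta> s $ 2 - \<beta> s $ 3) has_real_derivative f s) (at s) \<and>
     ((\<lambda>s. \<beta> s $ 3) has_real_derivative - (s\<^sup>2 + 1) * f s / 2 + b) (at s)"
    using assms by (auto simp: soliton_profile_def)
  have "((\<lambda>s. (\<mu> *\<^sub>R \<beta> s) $ 1) has_real_derivative - s * (\<mu> * f s)) (at s) \<and>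
     ((\<lambda>s. (\<mu> *\<^sub>R \<beta> s) $ 2 - (\<mu> *\<^sub>R \<beta> s) $ 3) has_real_derivative \<mu> * f s) (at s) \<and>
     ((\<lambda>s. (\<mu> *\<^sub>R \<beta> s) $ 3) has_real_derivative - (s\<^sup>2 + 1) * (\<mu> * f s) / 2 + \<mu> * b) (at s)"
    if "s \<in> I" for s
    using b[OF that, THEN conjunct1, THEN DERIV_cmult, of \<mu>]
      b[OF that, THEN conjunct2, THEN conjunct1, THEN DERIV_cmult, of \<mu>]
      b[OF that, THEN conjunct2, THEN conjunct2, THEN DERIV_cmult, of \<mu>]
    by (simp add: algebra_simps)
  then show ?thesis
    using assms by (auto simp: soliton_profile_def)
qed

text \<open>It suffices to exhibit antiderivatives: they agree with the components of \<open>\<beta>\<close> up to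
  additive constants, which make up the translation, and a discrepancy between the constants in the
  derivatives of the third components is absorbed by the linear term \<open>b s\<close>.\<close>

lemma soliton_profile_base_curve_form:
  assumes prof: "soliton_profile I \<beta> f"
    and \<Phi>: "\<And>s. s \<in> I \<Longrightarrow> (\<Phi> has_real_derivative f s) (at s)"
    and x: "\<And>s. s \<in> I \<Longrightarrow> (x has_real_derivative - s * f s) (at s)"
    and z: "\<And>s. s \<in> I \<Longrightarrow> (z has_real_derivative - (s\<^sup>2 + 1) * f s / 2 + b1) (at s)"
  shows "\<exists>c b. base_curve_form I (\<lambda>s. \<beta> s + c) \<Phi> x (\<lambda>s. z s + b * s)"
proof -
  obtain b0 where "convex I" and b0: "\<And>s. s \<in> I \<Longrightarrow>
     ((\<lambda>s. \<beta> s $ 1) has_real_derivative - s * f s) (at s) \<and>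
     ((\<lambda>s. \<beta> s $ 2 - \<beta> s $ 3) has_real_derivative f s) (at s) \<and>
     ((\<lambda>s. \<beta> s $ 3) has_real_derivative - (s\<^sup>2 + 1) * f s / 2 + b0) (at s)"
    using prof by (auto simp: soliton_profile_def)
  have z': "((\<lambda>s. z s + (b0 - b1) * s) has_real_derivative - (s\<^sup>2 + 1) * f s / 2 + b0) (at s)" if "s \<in> I" for s
    by (auto intro!: derivative_eq_intros z[OF that])
  obtain c1 where c1: "\<And>s. s \<in> I \<Longrightarrow> x s = \<beta> s $ 1 + c1"
    using equal_derivatives_differ_by_constant[OF \<open>convex I\<close> b0[THEN conjunct1] x] by blast
  obtain c2 where c2: "\<And>s. s \<in> I \<Longrightarrow> \<Phi> s = \<beta> s $ 2 - \<beta> s $ 3 + c2"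
    using equal_derivatives_differ_by_constant[OF \<open>convex I\<close> b0[THEN conjunct2, THEN conjunct1] \<Phi>] by blast
  obtain c3 where c3: "\<And>s. s \<in> I \<Longrightarrow> z s + (b0 - b1) * s = \<beta> s $ 3 + c3"
    using equal_derivatives_differ_by_constant[OF \<open>convex I\<close> b0[THEN conjunct2, THEN conjunct2] z'] by blast
  have "base_curve_form I (\<lambda>s. \<beta> s + vector [c1, c2 + c3, c3]) \<Phi> x (\<lambda>s. z s + (b0 - b1) * s)"
    by (simp add: base_curve_form_def vec_eq_iff forall_3 c1 c2 c3)
  then show ?thesis by blast
qed

text \<open>The value of \<open>ln\<close> at a negative number is \<open>log\<close> of its absolute value, so the derivative
  formula extends to all nonzero arguments.\<close>

lemma DERIV_ln_nonzero:
  fixes g :: "real \<Rightarrow> real"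
  assumes "(g has_real_derivative g') (at s)" "g s \<noteq> 0"
  shows "((\<lambda>s. ln (g s)) has_real_derivative g' / g s) (at s)"
proof (cases "g s > 0")
  case True
  then show ?thesis using assms by (auto intro!: derivative_eq_intros)
next
  case False
  then have "- g s > 0" using assms by auto
  then have "((\<lambda>s. ln (- g s)) has_real_derivative g' / g s) (at s)"
    using assms by (auto intro!: derivative_eq_intros simp: field_simps)
  then show ?thesis by (simp add: ln_minus)
qed

text \<open>This covers \<open>2 artanh\<close> both inside and outside the interval \<open>(-1, 1)\<close>.\<close>

lemma DERIV_ln_ratio:
  fixes g :: "real \<Rightarrow> real"
  assumes "(g has_real_derivative g') (at s)" "(g s)\<^sup>2 \<noteq> 1"
  shows "((\<lambda>s. ln ((1 + g s) / (1 - g s))) has_real_derivative 2 * g' / (1 - (g s)\<^sup>2)) (at s)"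
proof -
  have nz: "1 - g s \<noteq> 0" "1 + g s \<noteq> 0"
    using assms(2) by (auto simp: power2_eq_1_iff)
  have "((\<lambda>s. (1 + g s) / (1 - g s)) has_real_derivative 2 * g' / (1 - g s)\<^sup>2) (at s)"
    using nz by (auto intro!: derivative_eq_intros assms(1) simp: power2_eq_square field_simps)
  from DERIV_ln_nonzero[OF this] nz
  have "((\<lambda>s. ln ((1 + g s) / (1 - g s))) has_real_derivative
     (2 * g' / (1 - g s)\<^sup>2) / ((1 + g s) / (1 - g s))) (at s)" by simp
  moreover have "(2 * g' / (1 - g s)\<^sup>2) / ((1 + g s) / (1 - g s)) = 2 * g' / ((1 - g s) * (1 + g s))"
    using nz by (simp add: power2_eq_square)
  moreover have "(1 - g s) * (1 + g s) = 1 - (g s)\<^sup>2" by algebra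
  ultimately show ?thesis by simp
qed

section \<open>The explicit base curves\<close>

text \<open>The profile with affine reciprocal.  Polynomial division by \<open>2 \<epsilon> s + a\<close> turns \<open>s f\<close> and
  \<open>s\<^sup>2 f\<close> into multiples of \<open>f\<close> plus polynomials; the constant term \<open>- a / 8\<close> left over in the
  third component goes into the linear term of \<open>z\<close>.\<close>

lemma soliton_profile_log:
  assumes prof: "soliton_profile I \<beta> f" and eps: "\<epsilon> \<in> {-1, 1}"
    and f: "\<And>s. s \<in> I \<Longrightarrow> f s * (2 * \<epsilon> * s + a) = 1"
  shows "\<exists>c b. base_curve_form I (\<lambda>s. \<beta> s + c)
     (\<lambda>s. 1 / (2 * \<epsilon>) * ln (2 * \<epsilon> * s + a))
     (\<lambda>s. a * ln (2 * \<epsilon> * s + a) / 4 - s / (2 * \<epsilon>))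
     (\<lambda>s. - ((a\<^sup>2 + 4) * ln (2 * \<epsilon> * s + a) / (16 * \<epsilon>)) + b * s - s\<^sup>2 * \<epsilon> / 8)"
proof -
  have ln: "((\<lambda>s. ln (2 * \<epsilon> * s + a)) has_real_derivative 2 * \<epsilon> * f s) (at s)" if "s \<in> I" for s
  proof -
    have nz: "2 * \<epsilon> * s + a \<noteq> 0" using f[OF that] by auto
    then have "f s = 1 / (2 * \<epsilon> * s + a)" using f[OF that] by (simp add: eq_divide_eq)
    moreover have "((\<lambda>s. 2 * \<epsilon> * s + a) has_real_derivative 2 * \<epsilon>) (at s)"
      by (auto intro!: derivative_eq_intros)
    ultimately show ?thesis
      using DERIV_ln_nonzero[of "\<lambda>s. 2 * \<epsilon> * s + a", OF _ nz] by simp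
  qed
  have a: "a * f s = 1 - 2 * \<epsilon> * (s * f s)" if "s \<in> I" for s
    using f[OF that] by (simp add: algebra_simps)
  have "\<exists>c b. base_curve_form I (\<lambda>s. \<beta> s + c)
     (\<lambda>s. 1 / (2 * \<epsilon>) * ln (2 * \<epsilon> * s + a))
     (\<lambda>s. a * ln (2 * \<epsilon> * s + a) / 4 - s / (2 * \<epsilon>))
     (\<lambda>s. (- ((a\<^sup>2 + 4) * ln (2 * \<epsilon> * s + a) / (16 * \<epsilon>)) - s\<^sup>2 * \<epsilon> / 8) + b * s)"
  proof (rule soliton_profile_base_curve_form[OF prof, where ?b1.0 = "- a / 8"])
    fix s assume s: "s \<in> I"
    show "((\<lambda>s. 1 / (2 * \<epsilon>) * ln (2 * \<epsilon> * s + a)) has_real_derivative f s) (at s)"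
      using DERIV_cmult[OF ln[OF s], of "1 / (2 * \<epsilon>)"] eps by auto
    have "a * (2 * \<epsilon> * f s) / 4 - 1 / (2 * \<epsilon>) = - s * f s"
      using a[OF s] eps by (auto simp: field_simps)
    then show "((\<lambda>s. a * ln (2 * \<epsilon> * s + a) / 4 - s / (2 * \<epsilon>)) has_real_derivative - s * f s) (at s)"
      by (rule DERIV_cong[OF DERIV_diff[OF DERIV_cdivide[OF DERIV_cmult[OF ln[OF s]]] DERIV_cdivide[OF DERIV_ident]]])
    have "a\<^sup>2 * f s = a * (1 - 2 * \<epsilon> * (s * f s))"
      using a[OF s] by (simp add: power2_eq_square)
    also have "\<dots> = a - 2 * \<epsilon> * s + 4 * (s\<^sup>2 * f s)"
      using a[OF s] eps by (auto simp: power2_eq_square) algebra+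
    finally have z': "- ((a\<^sup>2 + 4) * (2 * \<epsilon> * f s) / (16 * \<epsilon>)) - 2 * s * \<epsilon> / 8 = - (s\<^sup>2 + 1) * f s / 2 + (- a / 8)"
      using eps by (auto simp: field_simps)
    have sq: "((\<lambda>s. s\<^sup>2 * \<epsilon> / 8) has_real_derivative 2 * s * \<epsilon> / 8) (at s)"
      by (auto intro!: derivative_eq_intros)
    from z' show "((\<lambda>s. - ((a\<^sup>2 + 4) * ln (2 * \<epsilon> * s + a) / (16 * \<epsilon>)) - s\<^sup>2 * \<epsilon> / 8)
        has_real_derivative - (s\<^sup>2 + 1) * f s / 2 + (- a / 8)) (at s)"
      by (rule DERIV_cong[OF DERIV_diff[OF DERIV_minus[OF DERIV_cdivide[OF DERIV_cmult[OF ln[OF s]]]] sq]])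
  qed
  then show ?thesis by (simp add: algebra_simps)
qed

text \<open>The profile whose reciprocal has a double root at \<open>v2\<close>.  In this and the next two cases
  \<open>s\<^sup>2 + 1\<close> is divided by the quadratic denominator, and the quotient contributes the constant
  \<open>- \<epsilon> / 2\<close> to the derivative of \<open>z\<close>.\<close>

lemma soliton_profile_rational:
  assumes prof: "soliton_profile I \<beta> f" and eps: "\<epsilon> \<in> {-1, 1}"
    and f: "\<And>s. s \<in> I \<Longrightarrow> f s * (\<epsilon> * (s - v2)\<^sup>2) = - 1"
  shows "\<exists>c b. base_curve_form I (\<lambda>s. \<beta> s + c)
     (\<lambda>s. 1 / (\<epsilon> * (s - v2)))
     (\<lambda>s. 1 / \<epsilon> * (ln (s - v2) - v2 / (s - v2)))
     (\<lambda>s. 1 / (2 * \<epsilon>) * (2 * v2 * ln (s - v2) - (1 + v2\<^sup>2) / (s - v2)) + b * s)"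
proof (rule soliton_profile_base_curve_form[OF prof, where ?b1.0 = "- \<epsilon> / 2"])
  fix s assume s: "s \<in> I"
  define d where "d = s - v2"
  have nz: "d \<noteq> 0" using f[OF s] by (auto simp: d_def)
  have fs: "f s = - \<epsilon> / d\<^sup>2" using f[OF s] eps nz by (auto simp: field_simps d_def)
  have sd: "s = d + v2" by (simp add: d_def)
  have ln: "((\<lambda>s. ln (s - v2)) has_real_derivative 1 / d) (at s)"
    using DERIV_ln_nonzero[of "\<lambda>s. s - v2", OF DERIV_diff[OF DERIV_ident DERIV_const]] nz
    by (simp add: d_def)
  have inv: "((\<lambda>s. k / (s - v2)) has_real_derivative - k / d\<^sup>2) (at s)" for k
    using nz by (auto simp: d_def power2_eq_square intro!: derivative_eq_intros)
  have "((\<lambda>s. (1 / \<epsilon>) / (s - v2)) has_real_derivative f s) (at s)"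
    using inv[of "1 / \<epsilon>"] fs eps by auto
  then show "((\<lambda>s. 1 / (\<epsilon> * (s - v2))) has_real_derivative f s) (at s)" by simp
  have "1 / \<epsilon> * (1 / d - - v2 / d\<^sup>2) = - s * f s"
    unfolding fs unfolding sd using eps nz by (auto simp: field_simps power2_eq_square)
  then show "((\<lambda>s. 1 / \<epsilon> * (ln (s - v2) - v2 / (s - v2))) has_real_derivative - s * f s) (at s)"
    by (rule DERIV_cong[OF DERIV_cmult[OF DERIV_diff[OF ln inv[of v2]], of "1 / \<epsilon>"]])
  have "1 / (2 * \<epsilon>) * (2 * v2 * (1 / d) - - (1 + v2\<^sup>2) / d\<^sup>2) = - (s\<^sup>2 + 1) * f s / 2 + (- \<epsilon> / 2)"
    unfolding fs unfolding sd using eps nz by (auto simp: field_simps power2_eq_square)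
  then show "((\<lambda>s. 1 / (2 * \<epsilon>) * (2 * v2 * ln (s - v2) - (1 + v2\<^sup>2) / (s - v2)))
      has_real_derivative - (s\<^sup>2 + 1) * f s / 2 + (- \<epsilon> / 2)) (at s)"
    by (rule DERIV_cong[OF DERIV_cmult[OF DERIV_diff[OF DERIV_cmult[OF ln, of "2 * v2"] inv[of "1 + v2\<^sup>2"]], of "1 / (2 * \<epsilon>)"]])
qed

text \<open>The profile whose reciprocal has no real root: \<open>a + \<epsilon> (s - v2)\<^sup>2 = a (1 + \<phi>\<^sup>2)\<close>, because
  \<open>p\<close> is chosen with \<open>a p\<^sup>2 = \<epsilon>\<close>.\<close>

lemma soliton_profile_arctan:
  assumes prof: "soliton_profile I \<beta> f" and eps: "\<epsilon> \<in> {-1, 1}"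
    and f: "\<And>s. s \<in> I \<Longrightarrow> f s * (a + \<epsilon> * (s - v2)\<^sup>2) = - 1"
    and sgn: "sgn \<epsilon> = sgn a"
  defines "p \<equiv> sqrt (\<epsilon> / a)"
  defines "\<phi> \<equiv> \<lambda>s. p * (s - v2)"
  shows "\<exists>c b. base_curve_form I (\<lambda>s. \<beta> s + c)
     (\<lambda>s. - (1 / (a * p)) * arctan (\<phi> s))
     (\<lambda>s. 1 / (2 * \<epsilon>) * ln (1 + (\<phi> s)\<^sup>2) + v2 / (a * p) * arctan (\<phi> s))
     (\<lambda>s. ((p\<^sup>2 * (v2\<^sup>2 + 1) - 1) * arctan (\<phi> s) + p * v2 * ln (1 + (\<phi> s)\<^sup>2)) / (2 * \<epsilon> * p) + b * s)"
proof (rule soliton_profile_base_curve_form[OF prof, where ?b1.0 = "- \<epsilon> / 2"])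
  fix s assume s: "s \<in> I"
  have pos: "\<epsilon> / a > 0"
    using eps sgn by (auto simp: sgn_if zero_less_divide_iff split: if_splits)
  then have p: "p > 0" and p2: "p\<^sup>2 = \<epsilon> / a" and "a \<noteq> 0"
    by (auto simp: p_def)
  then have ap: "a * p\<^sup>2 = \<epsilon>" by simp
  define m where "m = 1 + (\<phi> s)\<^sup>2"
  have "m > 0" by (simp add: m_def add_pos_nonneg)
  have am: "a * m = a + \<epsilon> * (s - v2)\<^sup>2"
    unfolding ap[symmetric] m_def \<phi>_def by algebra
  have fs: "f s = - 1 / (a * m)"
    using f[OF s] unfolding am[symmetric] using \<open>m > 0\<close> \<open>a \<noteq> 0\<close> by (simp add: field_simps)
  have \<phi>: "(\<phi> has_real_derivative p) (at s)"
    by (auto simp: \<phi>_def intro!: derivative_eq_intros)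
  have at: "((\<lambda>s. arctan (\<phi> s)) has_real_derivative p / m) (at s)"
    by (auto simp: m_def divide_inverse intro!: derivative_eq_intros \<phi>)
  have ln: "((\<lambda>s. ln (1 + (\<phi> s)\<^sup>2)) has_real_derivative 2 * p\<^sup>2 * (s - v2) / m) (at s)"
    using \<open>m > 0\<close> unfolding m_def
    by (auto intro!: derivative_eq_intros \<phi> simp: \<phi>_def power2_eq_square)
  have "- (1 / (a * p)) * (p / m) = f s"
    using p by (simp add: fs)
  then show "((\<lambda>s. - (1 / (a * p)) * arctan (\<phi> s)) has_real_derivative f s) (at s)"
    by (rule DERIV_cong[OF DERIV_cmult[OF at]])
  have "1 / (2 * \<epsilon>) * (2 * p\<^sup>2 * (s - v2) / m) + v2 / (a * p) * (p / m) = - s * f s"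
    unfolding p2 fs using p \<open>m > 0\<close> \<open>a \<noteq> 0\<close> eps by (auto simp: field_simps)
  then show "((\<lambda>s. 1 / (2 * \<epsilon>) * ln (1 + (\<phi> s)\<^sup>2) + v2 / (a * p) * arctan (\<phi> s)) has_real_derivative - s * f s) (at s)"
    by (rule DERIV_cong[OF DERIV_add[OF DERIV_cmult[OF ln] DERIV_cmult[OF at]]])
  have "((p\<^sup>2 * (v2\<^sup>2 + 1) - 1) * (p / m) + p * v2 * (2 * p\<^sup>2 * (s - v2) / m)) / (2 * \<epsilon> * p)
     = ((p\<^sup>2 * (v2\<^sup>2 + 1) - 1) + v2 * (2 * p\<^sup>2 * (s - v2))) / m / (2 * \<epsilon>)"
    using p \<open>m > 0\<close> eps by (auto simp: field_simps)
  also have "\<dots> = (v2\<^sup>2 + 1 - a * \<epsilon> + 2 * v2 * (s - v2)) / (2 * (a * m))"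
    unfolding p2 using p \<open>m > 0\<close> \<open>a \<noteq> 0\<close> eps by (auto simp: field_simps)
  also have "\<dots> = (s\<^sup>2 + 1 - \<epsilon> * (a * m)) / (2 * (a * m))"
    unfolding am using eps by (auto simp: power2_eq_square algebra_simps)
  also have "\<dots> = - (s\<^sup>2 + 1) * f s / 2 + (- \<epsilon> / 2)"
    unfolding fs using \<open>m > 0\<close> \<open>a \<noteq> 0\<close> by (simp add: field_simps)
  finally show "((\<lambda>s. ((p\<^sup>2 * (v2\<^sup>2 + 1) - 1) * arctan (\<phi> s) + p * v2 * ln (1 + (\<phi> s)\<^sup>2)) / (2 * \<epsilon> * p))
      has_real_derivative - (s\<^sup>2 + 1) * f s / 2 + (- \<epsilon> / 2)) (at s)"
    by (rule DERIV_cong[OF DERIV_cdivide[OF DERIV_add[OF DERIV_cmult[OF at] DERIV_cmult[OF ln]]]])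
qed

text \<open>The profile whose reciprocal has two real roots: \<open>a + \<epsilon> (s - v2)\<^sup>2 = a (1 - \<phi>\<^sup>2)\<close>, because
  \<open>p\<close> is chosen with \<open>a p\<^sup>2 = - \<epsilon>\<close>.  The roots \<open>\<phi> = \<plusminus> 1\<close> are excluded since there the
  product with \<open>f\<close> would vanish.\<close>

lemma soliton_profile_artanh:
  assumes prof: "soliton_profile I \<beta> f" and eps: "\<epsilon> \<in> {-1, 1}"
    and f: "\<And>s. s \<in> I \<Longrightarrow> f s * (a + \<epsilon> * (s - v2)\<^sup>2) = - 1"
    and "a \<noteq> 0" and sgn: "sgn \<epsilon> = - sgn a"
  defines "p \<equiv> sqrt (- \<epsilon> / a)"
  defines "\<phi> \<equiv> \<lambda>s. p * (s - v2)"
  shows "\<forall>s\<in>I. (\<phi> s)\<^sup>2 \<noteq> 1"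
    and "\<exists>c b. base_curve_form I (\<lambda>s. \<beta> s + c)
     (\<lambda>s. - (1 / (2 * p * a)) * ln ((1 + \<phi> s) / (1 - \<phi> s)))
     (\<lambda>s. 1 / (2 * \<epsilon>) * ln (1 - (\<phi> s)\<^sup>2) + v2 / (2 * a * p) * ln ((1 + \<phi> s) / (1 - \<phi> s)))
     (\<lambda>s. \<epsilon> * v2 / 2 * ln (1 - (\<phi> s)\<^sup>2) + (1 - a * \<epsilon> + v2\<^sup>2) / (2 * a * p) * artanh (\<phi> s) + b * s)"
proof -
  have pos: "- \<epsilon> / a > 0"
    using eps sgn \<open>a \<noteq> 0\<close> by (auto simp: sgn_if zero_less_divide_iff split: if_splits)
  then have p: "p > 0" and p2: "p\<^sup>2 = - \<epsilon> / a"
    by (auto simp: p_def)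
  then have ap: "a * p\<^sup>2 = - \<epsilon>" using \<open>a \<noteq> 0\<close> by simp
  have am: "a * (1 - (\<phi> s)\<^sup>2) = a + \<epsilon> * (s - v2)\<^sup>2" for s
    using ap unfolding \<phi>_def by algebra
  show nz: "\<forall>s\<in>I. (\<phi> s)\<^sup>2 \<noteq> 1"
    using f unfolding am[symmetric] by force
  show "\<exists>c b. base_curve_form I (\<lambda>s. \<beta> s + c)
     (\<lambda>s. - (1 / (2 * p * a)) * ln ((1 + \<phi> s) / (1 - \<phi> s)))
     (\<lambda>s. 1 / (2 * \<epsilon>) * ln (1 - (\<phi> s)\<^sup>2) + v2 / (2 * a * p) * ln ((1 + \<phi> s) / (1 - \<phi> s)))
     (\<lambda>s. \<epsilon> * v2 / 2 * ln (1 - (\<phi> s)\<^sup>2) + (1 - a * \<epsilon> + v2\<^sup>2) / (2 * a * p) * artanh (\<phi> s) + b * s)"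
  proof (rule soliton_profile_base_curve_form[OF prof, where ?b1.0 = "- \<epsilon> / 2"])
    fix s assume s: "s \<in> I"
    define m where "m = 1 - (\<phi> s)\<^sup>2"
    have "m \<noteq> 0" using nz s by (simp add: m_def)
    note am = am[of s, folded m_def]
    have fs: "f s = - 1 / (a * m)"
      using f[OF s] unfolding am[symmetric] using \<open>m \<noteq> 0\<close> \<open>a \<noteq> 0\<close> by (simp add: field_simps)
    have \<phi>: "(\<phi> has_real_derivative p) (at s)"
      by (auto simp: \<phi>_def intro!: derivative_eq_intros)
    have rt: "((\<lambda>s. ln ((1 + \<phi> s) / (1 - \<phi> s))) has_real_derivative 2 * p / m) (at s)"
      unfolding m_def by (rule DERIV_ln_ratio[OF \<phi>]) (use nz s in auto)
    have at: "((\<lambda>s. artanh (\<phi> s)) has_real_derivative p / m) (at s)"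
      unfolding artanh_def using DERIV_cdivide[OF rt, of 2] by simp
    have "((\<lambda>s. 1 - (\<phi> s)\<^sup>2) has_real_derivative - 2 * p\<^sup>2 * (s - v2)) (at s)"
      by (auto intro!: derivative_eq_intros \<phi> simp: \<phi>_def power2_eq_square)
    then have ln: "((\<lambda>s. ln (1 - (\<phi> s)\<^sup>2)) has_real_derivative - 2 * p\<^sup>2 * (s - v2) / m) (at s)"
      using DERIV_ln_nonzero \<open>m \<noteq> 0\<close> unfolding m_def by blast
    have "- (1 / (2 * p * a)) * (2 * p / m) = f s"
      using p by (simp add: fs)
    then show "((\<lambda>s. - (1 / (2 * p * a)) * ln ((1 + \<phi> s) / (1 - \<phi> s))) has_real_derivative f s) (at s)"
      by (rule DERIV_cong[OF DERIV_cmult[OF rt]])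
    have "1 / (2 * \<epsilon>) * (- 2 * p\<^sup>2 * (s - v2) / m) + v2 / (2 * a * p) * (2 * p / m) = - s * f s"
      unfolding p2 fs using p \<open>m \<noteq> 0\<close> \<open>a \<noteq> 0\<close> eps by (auto simp: field_simps)
    then show "((\<lambda>s. 1 / (2 * \<epsilon>) * ln (1 - (\<phi> s)\<^sup>2) + v2 / (2 * a * p) * ln ((1 + \<phi> s) / (1 - \<phi> s)))
        has_real_derivative - s * f s) (at s)"
      by (rule DERIV_cong[OF DERIV_add[OF DERIV_cmult[OF ln] DERIV_cmult[OF rt]]])
    have "\<epsilon> * v2 / 2 * (- 2 * p\<^sup>2 * (s - v2) / m) + (1 - a * \<epsilon> + v2\<^sup>2) / (2 * a * p) * (p / m)
       = (v2\<^sup>2 + 1 - a * \<epsilon> + 2 * v2 * (s - v2)) / (2 * (a * m))"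
      unfolding p2 using p \<open>m \<noteq> 0\<close> \<open>a \<noteq> 0\<close> eps by (auto simp: field_simps)
    also have "\<dots> = (s\<^sup>2 + 1 - \<epsilon> * (a * m)) / (2 * (a * m))"
      unfolding am using eps by (auto simp: power2_eq_square algebra_simps)
    also have "\<dots> = - (s\<^sup>2 + 1) * f s / 2 + (- \<epsilon> / 2)"
      unfolding fs using \<open>m \<noteq> 0\<close> \<open>a \<noteq> 0\<close> by (simp add: field_simps)
    finally show "((\<lambda>s. \<epsilon> * v2 / 2 * ln (1 - (\<phi> s)\<^sup>2) + (1 - a * \<epsilon> + v2\<^sup>2) / (2 * a * p) * artanh (\<phi> s))
        has_real_derivative - (s\<^sup>2 + 1) * f s / 2 + (- \<epsilon> / 2)) (at s)"
      by (rule DERIV_cong[OF DERIV_add[OF DERIV_cmult[OF ln] DERIV_cmult[OF at]]])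
  qed
qed

section \<open>Base curves orthogonal to the rulings\<close>

text \<open>As \<open>\<langle>w, w\<rangle> = 1\<close> and \<open>\<langle>a, w\<rangle> = 0\<close>, orthogonality of \<open>(\<gamma> + h w)' = \<gamma>' + h' w + h a\<close> to
  \<open>w\<close> only involves \<open>h'\<close>.\<close>

lemma orthogonal_shift_iff:
  assumes d1: "\<And>s. s \<in> I \<Longrightarrow> (\<gamma> has_vector_derivative \<gamma>1 s) (at s)"
  shows "orthogonal_shift I \<gamma> ruling h \<longleftrightarrow> smooth_on I h \<and>
    (\<forall>s\<in>I. (h has_real_derivative - mink (\<gamma>1 s) (ruling s)) (at s))"
proof -
  have "mink (vector_derivative (\<lambda>s. \<gamma> s + h s *\<^sub>R ruling s) (at s)) (ruling s) = 0
      \<longleftrightarrow> (h has_real_derivative - mink (\<gamma>1 s) (ruling s)) (at s)"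
    if smooth: "smooth_on I h" and s: "s \<in> I" for s
  proof -
    obtain h' where h': "(h has_real_derivative h') (at s)"
      using iterated_deriv_has_vector_derivative[OF smooth s, of 0]
      by (auto simp: has_real_derivative_iff_has_vector_derivative)
    have "((\<lambda>s. \<gamma> s + h s *\<^sub>R ruling s) has_vector_derivative
        \<gamma>1 s + (h s *\<^sub>R avec + h' *\<^sub>R ruling s)) (at s)"
      by (intro has_vector_derivative_add has_vector_derivative_scaleR d1 s h' ruling_has_vector_derivative)
    then have "vector_derivative (\<lambda>s. \<gamma> s + h s *\<^sub>R ruling s) (at s) =
        \<gamma>1 s + (h s *\<^sub>R avec + h' *\<^sub>R ruling s)"
      by (rule vector_derivative_at)
    moreover have "mink avec (ruling s) = 0" "mink (ruling s) (ruling s) = 1"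
      by (simp_all add: mink_def)
    ultimately have "mink (vector_derivative (\<lambda>s. \<gamma> s + h s *\<^sub>R ruling s) (at s)) (ruling s)
        = mink (\<gamma>1 s) (ruling s) + h'"
      by (simp add: mink.add_left mink.scaleR_left)
    moreover have "(h has_real_derivative d) (at s) \<longleftrightarrow> d = h'" for d
      using h' by (metis DERIV_unique)
    moreover have "mink (\<gamma>1 s) (ruling s) + h' = 0 \<longleftrightarrow> - mink (\<gamma>1 s) (ruling s) = h'"
      by (metis add_eq_0_iff minus_minus)
    ultimately show ?thesis
      by (simp only:)
  qed
  then show ?thesis
    unfolding orthogonal_shift_def by blast
qed

text \<open>The shift is an antiderivative of \<open>- \<langle>\<gamma>', w\<rangle>\<close>.  Its higher derivatives are explicit, since
  \<open>w\<close> is affine in \<open>s\<close>: the Leibniz formula for the derivative of order \<open>n\<close> of \<open>\<langle>\<gamma>', w\<rangle>\<close> has the two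
  terms of \<open>k n\<close> below.\<close>

lemma orthogonal_shift_exists:
  fixes \<gamma> :: "real \<Rightarrow> real^3"
  assumes "open I" "connected I" "smooth_on I \<gamma>"
  shows "\<exists>h. orthogonal_shift I \<gamma> ruling h"
proof -
  define g where "g n = iterated_deriv \<gamma> (replicate n 1)" for n
  have g: "(g n has_vector_derivative g (Suc n) s) (at s)" if "s \<in> I" for n s
    unfolding g_def by (rule iterated_deriv_has_vector_derivative[OF assms(3) that])
  define k where "k n s = mink (g (Suc n) s) (ruling s) + real n * mink (g n s) avec" for n s
  have k: "(k n has_vector_derivative k (Suc n) s) (at s)" if "s \<in> I" for n s
  proof -
    have "(k n has_vector_derivative
       (mink (g (Suc n) s) avec + mink (g (Suc (Suc n)) s) (ruling s)) +
        real n * mink (g (Suc n) s) avec) (at s)"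
      unfolding k_def
      by (intro derivative_intros mink.has_vector_derivative g that ruling_has_vector_derivative
          bounded_linear.has_vector_derivative[OF mink.bounded_linear_left])
    then show ?thesis by (simp add: k_def algebra_simps)
  qed
  have "continuous_on I (\<lambda>s. - k 0 s)"
    by (intro continuous_on_minus continuous_at_imp_continuous_on ballI)
      (meson k has_vector_derivative_continuous)
  then obtain h where h: "\<And>s. s \<in> I \<Longrightarrow> (h has_vector_derivative - k 0 s) (at s)"
    using antiderivative_on_open_interval[OF assms(1,2)] by blast
  let ?H = "\<lambda>n. case n of 0 \<Rightarrow> h | Suc m \<Rightarrow> \<lambda>s. - k m s"
  have "(?H n has_vector_derivative ?H (Suc n) s) (at s)" if "s \<in> I" for n s
    using h[OF that] k[OF that] by (cases n) (auto intro: has_vector_derivative_minus)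
  from smooth_on_derivative_sequence[of I ?H, OF assms(1) this]
  have "smooth_on I h" by simp
  have \<gamma>: "(\<gamma> has_vector_derivative g 1 s) (at s)" if "s \<in> I" for s
    using g[OF that, of 0] by (simp add: g_def)
  have "(h has_real_derivative - mink (g 1 s) (ruling s)) (at s)" if "s \<in> I" for s
    using h[OF that] by (simp add: k_def has_real_derivative_iff_has_vector_derivative)
  with \<open>smooth_on I h\<close> have "orthogonal_shift I \<gamma> ruling h"
    using orthogonal_shift_iff[OF \<gamma>] by simp
  then show ?thesis by blast
qed

text \<open>With \<open>h' = - \<langle>\<gamma>', w\<rangle>\<close> the equation for \<open>\<gamma>3''\<close> becomes \<open>z'' = - s q - (s\<^sup>2 + 1) q' / 2\<close> for
  the third component \<open>z = \<gamma>3 + h s\<close>, and the right-hand side is the derivative of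
  \<open>- (s\<^sup>2 + 1) q / 2\<close>.\<close>

lemma soliton_profile_of_orthogonal_base_curve:
  fixes \<gamma> :: "real \<Rightarrow> real^3"
  assumes "convex I"
    and d1: "\<And>s. s \<in> I \<Longrightarrow> (\<gamma> has_vector_derivative \<gamma>1 s) (at s)"
    and d2: "\<And>s. s \<in> I \<Longrightarrow> (\<gamma>1 has_vector_derivative \<gamma>2 s) (at s)"
    and h: "\<And>s. s \<in> I \<Longrightarrow> (h has_real_derivative - mink (\<gamma>1 s) (ruling s)) (at s)"
    and eq: "\<And>s. s \<in> I \<Longrightarrow> \<gamma>2 s $ 3 = s * \<gamma>2 s $ 1 + 2 * (\<gamma>1 s $ 1 + s * mink (\<gamma>1 s) avec)
       - (1 - s\<^sup>2) * mink (\<gamma>2 s) avec / 2"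
  shows "soliton_profile I (\<lambda>s. \<gamma> s + h s *\<^sub>R ruling s) (\<lambda>s. mink (\<gamma>1 s) avec)"
proof -
  let ?q = "\<lambda>s. mink (\<gamma>1 s) avec" and ?F = "\<lambda>s. mink (\<gamma>1 s) (ruling s)"
  note \<gamma> = vector_derivative_components[OF d1] and \<gamma>1 = vector_derivative_components[OF d2]
  have F: "?F s = \<gamma>1 s $ 1 + s * ?q s" for s
    by (simp add: mink_def algebra_simps)
  have q: "(?q has_real_derivative mink (\<gamma>2 s) avec) (at s)" if "s \<in> I" for s
    unfolding mink_def using that by (auto intro!: derivative_eq_intros \<gamma>1)
  define z' where "z' s = \<gamma>1 s $ 3 + h s - s * (\<gamma>1 s $ 1 + s * ?q s)" for s
  have z: "((\<lambda>s. \<gamma> s $ 3 + h s * s) has_real_derivative z' s) (at s)" if "s \<in> I" for s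
    using that by (auto intro!: derivative_eq_intros \<gamma> h simp: F z'_def algebra_simps)
  have "(z' has_real_derivative - s * ?q s - (s\<^sup>2 + 1) * mink (\<gamma>2 s) avec / 2) (at s)" if "s \<in> I" for s
    unfolding z'_def using that
    by (auto intro!: derivative_eq_intros \<gamma>1 q h simp: F eq[OF that])
      (simp add: field_simps power2_eq_square)
  moreover have "((\<lambda>s. - (s\<^sup>2 + 1) * ?q s / 2) has_real_derivative
       - s * ?q s - (s\<^sup>2 + 1) * mink (\<gamma>2 s) avec / 2) (at s)" if "s \<in> I" for s
    using that by (auto intro!: derivative_eq_intros q simp: field_simps)
  ultimately obtain b where b: "\<And>s. s \<in> I \<Longrightarrow> z' s = - (s\<^sup>2 + 1) * ?q s / 2 + b"
    using equal_derivatives_differ_by_constant[OF \<open>convex I\<close>, 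
        of "\<lambda>s. - (s\<^sup>2 + 1) * ?q s / 2" "\<lambda>s. - s * ?q s - (s\<^sup>2 + 1) * mink (\<gamma>2 s) avec / 2" z']
    by blast
  have "((\<lambda>s. \<gamma> s $ 1 + h s) has_real_derivative - s * ?q s) (at s)"
    "((\<lambda>s. \<gamma> s $ 2 - \<gamma> s $ 3) has_real_derivative ?q s) (at s)"
    "((\<lambda>s. \<gamma> s $ 3 + h s * s) has_real_derivative - (s\<^sup>2 + 1) * ?q s / 2 + b) (at s)" if "s \<in> I" for s
  proof -
    show "((\<lambda>s. \<gamma> s $ 1 + h s) has_real_derivative - s * ?q s) (at s)"
      using DERIV_add[OF \<gamma>[OF that, of 1] h[OF that]] by (simp add: F)
    show "((\<lambda>s. \<gamma> s $ 2 - \<gamma> s $ 3) has_real_derivative ?q s) (at s)"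
      using DERIV_diff[OF \<gamma>[OF that, of 2] \<gamma>[OF that, of 3]] by (simp add: mink_def)
    show "((\<lambda>s. \<gamma> s $ 3 + h s * s) has_real_derivative - (s\<^sup>2 + 1) * ?q s / 2 + b) (at s)"
      using z[OF that] b[OF that] by simp
  qed
  then show ?thesis
    using \<open>convex I\<close> unfolding soliton_profile_def by auto
qed

text \<open>The equation is separable: \<open>(1 / q)' = - q' / q\<^sup>2\<close> is affine in \<open>s\<close>.\<close>

lemma reciprocal_antiderivative:
  fixes q :: "real \<Rightarrow> real"
  assumes "convex I" and eps: "\<epsilon> \<in> {-1, 1}"
    and q: "\<And>s. s \<in> I \<Longrightarrow> (q has_real_derivative q' s) (at s)"
    and nz: "\<And>s. s \<in> I \<Longrightarrow> q s \<noteq> 0"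
    and eq: "\<And>s. s \<in> I \<Longrightarrow> \<epsilon> * q' s = 2 * (q s)\<^sup>2 * (s * v1 - v3)"
  shows "\<exists>k. \<forall>s\<in>I. q s * (k - \<epsilon> * (v1 * s\<^sup>2 - 2 * v3 * s)) = 1"
proof -
  have "((\<lambda>s. 1 / q s) has_real_derivative - 2 * \<epsilon> * (s * v1 - v3)) (at s)" if "s \<in> I" for s
  proof -
    have "q' s = \<epsilon> * (2 * (q s)\<^sup>2 * (s * v1 - v3))"
      using eq[OF that] eps by auto
    then show ?thesis
      using nz[OF that] by (auto intro!: derivative_eq_intros q that simp: power2_eq_square)
  qed
  moreover have "((\<lambda>s. - \<epsilon> * (v1 * s\<^sup>2 - 2 * v3 * s)) has_real_derivative - 2 * \<epsilon> * (s * v1 - v3)) (at s)" for s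
    by (auto intro!: derivative_eq_intros simp: algebra_simps)
  ultimately obtain k where k: "\<And>s. s \<in> I \<Longrightarrow> 1 / q s = - \<epsilon> * (v1 * s\<^sup>2 - 2 * v3 * s) + k"
    using equal_derivatives_differ_by_constant[OF \<open>convex I\<close>, of "\<lambda>s. - \<epsilon> * (v1 * s\<^sup>2 - 2 * v3 * s)"
        "\<lambda>s. - 2 * \<epsilon> * (s * v1 - v3)" "\<lambda>s. 1 / q s"]
    by blast
  have "q s * (k - \<epsilon> * (v1 * s\<^sup>2 - 2 * v3 * s)) = q s * (1 / q s)" if "s \<in> I" for s
    unfolding k[OF that] by (simp add: algebra_simps)
  then show ?thesis
    using nz by auto
qed

section \<open>Classification\<close>

theorem theorem4p3:
  fixes \<gamma> :: "real \<Rightarrow> real^3" and D :: "(real^2) set" and I :: "real set"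
    and N :: "real^2 \<Rightarrow> real^3" and v :: "real^3"
  assumes "I = (\<lambda>u. u $ 1) ` D"
    and "regular_curve I \<gamma>"
    and "\<not> cylindrical I ruling"
    and "translating_soliton D (ruled \<gamma> ruling) N v"
  shows "(\<forall>s\<in>I. mink (vector_derivative \<gamma> (at s)) avec \<noteq> 0) \<and>
    mink avec v = 0 \<and>
    (\<exists>h. orthogonal_shift I \<gamma> ruling h) \<and>
    (v \<noteq> 0 \<longrightarrow>
     (\<exists>\<epsilon>\<in>{-1, 1::real}. (\<forall>u\<in>D. mink (N u) (N u) = \<epsilon>) \<and>
      (\<forall>h. orthogonal_shift I \<gamma> ruling h \<longrightarrow>
       (\<exists>(\<mu>::real) (c::real^3) (\<beta>::real \<Rightarrow> real^3). \<mu> \<noteq> 0 \<and>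
         \<beta> = (\<lambda>s. \<mu> *\<^sub>R (\<gamma> s + h s *\<^sub>R ruling s) + c) \<and>
         (
          ((1 / \<mu>) *\<^sub>R v = vector [0, 1, 1] \<and>
           (\<exists>a b :: real.
             (\<forall>s\<in>I. 2 * \<epsilon> * s + a \<noteq> 0) \<and>
             base_curve_form I \<beta>
               (\<lambda>s. 1 / (2 * \<epsilon>) * ln (2 * \<epsilon> * s + a))
               (\<lambda>s. a * ln (2 * \<epsilon> * s + a) / 4 - s / (2 * \<epsilon>))
               (\<lambda>s. - ((a\<^sup>2 + 4) * ln (2 * \<epsilon> * s + a) / (16 * \<epsilon>)) + b * s - s\<^sup>2 * \<epsilon> / 8)))
          \<or>
          (\<exists>v2 :: real. (1 / \<mu>) *\<^sub>R v = vector [1, v2, v2] \<and>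
           (
            (\<exists>b :: real.
              (\<forall>s\<in>I. s \<noteq> v2) \<and>
              base_curve_form I \<beta>
                (\<lambda>s. 1 / (\<epsilon> * (s - v2)))
                (\<lambda>s. 1 / \<epsilon> * (ln (s - v2) - v2 / (s - v2)))
                (\<lambda>s. 1 / (2 * \<epsilon>) * (2 * v2 * ln (s - v2) - (1 + v2\<^sup>2) / (s - v2)) + b * s))
            \<or>
            (\<exists>(a::real) (b::real) (p::real) (\<phi>::real \<Rightarrow> real). a \<noteq> 0 \<and>
              sgn \<epsilon> = sgn a \<and> p = sqrt (\<epsilon> / a) \<and> \<phi> = (\<lambda>s. p * (s - v2)) \<and>
              base_curve_form I \<beta>
                (\<lambda>s. - (1 / (a * p)) * arctan (\<phi> s))
                (\<lambda>s. 1 / (2 * \<epsilon>) * ln (1 + (\<phi> s)\<^sup>2) + v2 / (a * p) * arctan (\<phi> s))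
                (\<lambda>s. ((p\<^sup>2 * (v2\<^sup>2 + 1) - 1) * arctan (\<phi> s) + p * v2 * ln (1 + (\<phi> s)\<^sup>2))
                       / (2 * \<epsilon> * p) + b * s))
            \<or>
            (\<exists>(a::real) (b::real) (p::real) (\<phi>::real \<Rightarrow> real). a \<noteq> 0 \<and>
              sgn \<epsilon> = - sgn a \<and> p = sqrt (- \<epsilon> / a) \<and> \<phi> = (\<lambda>s. p * (s - v2)) \<and>
              (\<forall>s\<in>I. (\<phi> s)\<^sup>2 \<noteq> 1) \<and>
              base_curve_form I \<beta>
                (\<lambda>s. - (1 / (2 * p * a)) * ln ((1 + \<phi> s) / (1 - \<phi> s)))
                (\<lambda>s. 1 / (2 * \<epsilon>) * ln (1 - (\<phi> s)\<^sup>2)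
                       + v2 / (2 * a * p) * ln ((1 + \<phi> s) / (1 - \<phi> s)))
                (\<lambda>s. \<epsilon> * v2 / 2 * ln (1 - (\<phi> s)\<^sup>2)
                       + (1 - a * \<epsilon> + v2\<^sup>2) / (2 * a * p) * artanh (\<phi> s) + b * s))))
         )))))"

proof -
  let ?X = "ruled \<gamma> ruling" and ?q = "\<lambda>s. mink (vector_derivative \<gamma> (at s)) avec"
  have nd: "nondegenerate_surface D ?X" and unit: "unit_normal_field D ?X N"
    using assms(4) by (auto simp: translating_soliton_def)
  then have "open D" "connected D" "D \<noteq> {}"
    by (auto simp: nondegenerate_surface_def)
  have "open I"
    unfolding assms(1) by (rule open_image_vec_nth[OF \<open>open D\<close>])
  have "connected I"
    unfolding assms(1) by (intro connected_continuous_image continuous_intros \<open>connected D\<close>)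
  then have "convex I"
    by (simp add: is_interval_connected_1[symmetric] is_interval_convex_1)
  have smooth: "smooth_on I \<gamma>"
    using assms(2) by (simp add: regular_curve_def)
  define \<gamma>1 where "\<gamma>1 = iterated_deriv \<gamma> [1]"
  define \<gamma>2 where "\<gamma>2 = iterated_deriv \<gamma> [1, 1]"
  have d1: "(\<gamma> has_vector_derivative \<gamma>1 s) (at s)" if "s \<in> I" for s
    using iterated_deriv_has_vector_derivative[OF smooth that, of 0] by (simp add: \<gamma>1_def)
  have d2: "(\<gamma>1 has_vector_derivative \<gamma>2 s) (at s)" if "s \<in> I" for s
    using iterated_deriv_has_vector_derivative[OF smooth that, of 1] by (simp add: \<gamma>1_def \<gamma>2_def)
  obtain \<epsilon> where eps: "\<epsilon> \<in> {-1, 1}" and N: "\<And>u. u \<in> D \<Longrightarrow> mink (N u) (N u) = \<epsilon>"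
    using unit_normal_field_causal_character[OF \<open>connected D\<close> unit] by blast
  have eqs: "mink (\<gamma>1 s) avec \<noteq> 0" "mink avec v = 0"
    "\<epsilon> * mink (\<gamma>2 s) avec = 2 * (mink (\<gamma>1 s) avec)\<^sup>2 * (s * v $ 1 - v $ 3)"
    "\<gamma>2 s $ 3 = s * \<gamma>2 s $ 1 + 2 * (\<gamma>1 s $ 1 + s * mink (\<gamma>1 s) avec) - (1 - s\<^sup>2) * mink (\<gamma>2 s) avec / 2"
    if "s \<in> I" for s
    by (rule soliton_profile_equations[OF \<open>open D\<close> \<open>open I\<close> assms(1) d1 d2 assms(4) N eps that]; assumption)+
  define v1 v3 where "v1 = v $ 1" and "v3 = v $ 3"
  have v\<^sub>a: "mink avec v = 0"
    using eqs(2) \<open>D \<noteq> {}\<close> assms(1) by blast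
  then have v: "v = vector [v1, v3, v3]"
    by (simp add: mink_def vec_eq_iff forall_3 v1_def v3_def)
  have q: "((\<lambda>s. mink (\<gamma>1 s) avec) has_real_derivative mink (\<gamma>2 s) avec) (at s)" if "s \<in> I" for s
    using bounded_linear.has_vector_derivative[OF mink.bounded_linear_left d2[OF that]]
    by (simp add: has_real_derivative_iff_has_vector_derivative)
  obtain k where k: "\<And>s. s \<in> I \<Longrightarrow> mink (\<gamma>1 s) avec * (k - \<epsilon> * (v1 * s\<^sup>2 - 2 * v3 * s)) = 1"
    using reciprocal_antiderivative[OF \<open>convex I\<close> eps q eqs(1) eqs(3)] unfolding v1_def v3_def by blast
  show ?thesis
  proof (intro conjI impI bexI[OF _ eps] ballI allI, goal_cases)
    case (1 s)
    then show ?case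
      using eqs(1) vector_derivative_at[OF d1] by simp
  next
    case 2
    show ?case by (rule v\<^sub>a)
  next
    case 3
    show ?case
      by (rule orthogonal_shift_exists[OF \<open>open I\<close> \<open>connected I\<close> smooth])
  next
    case (4 u)
    show ?case by (rule N[OF 4(2)])
  next
    case (5 h)
    then have h: "(h has_real_derivative - mink (\<gamma>1 s) (ruling s)) (at s)" if "s \<in> I" for s
      using that by (simp add: orthogonal_shift_iff[OF d1])
    have prof: "soliton_profile I (\<lambda>s. \<mu> *\<^sub>R (\<gamma> s + h s *\<^sub>R ruling s)) (\<lambda>s. \<mu> * mink (\<gamma>1 s) avec)" for \<mu>
      by (intro soliton_profile_scaleR soliton_profile_of_orthogonal_base_curve[OF \<open>convex I\<close> d1 d2 h eqs(4)])
    show ?case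
    proof (cases "v1 = 0")
      case True
      have "v3 \<noteq> 0"
        using 5 True by (auto simp: v vec_eq_iff forall_3)
      \<comment> \<open>After dilation by \<open>v3\<close> the reciprocal of the profile is affine.\<close>
      have f: "v3 * mink (\<gamma>1 s) avec * (2 * \<epsilon> * s + k / v3) = 1" if "s \<in> I" for s
        using k[OF that] \<open>v3 \<noteq> 0\<close> True by (simp add: algebra_simps)
      obtain c b where form: "base_curve_form I (\<lambda>s. v3 *\<^sub>R (\<gamma> s + h s *\<^sub>R ruling s) + c)
         (\<lambda>s. 1 / (2 * \<epsilon>) * ln (2 * \<epsilon> * s + k / v3))
         (\<lambda>s. k / v3 * ln (2 * \<epsilon> * s + k / v3) / 4 - s / (2 * \<epsilon>))
         (\<lambda>s. - (((k / v3)\<^sup>2 + 4) * ln (2 * \<epsilon> * s + k / v3) / (16 * \<epsilon>)) + b * s - s\<^sup>2 * \<epsilon> / 8)"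
        using soliton_profile_log[OF prof eps f] by blast
      have "\<forall>s\<in>I. 2 * \<epsilon> * s + k / v3 \<noteq> 0"
        using f by force
      moreover have "(1 / v3) *\<^sub>R v = vector [0, 1, 1]"
        using True \<open>v3 \<noteq> 0\<close> by (simp add: v vec_eq_iff forall_3)
      ultimately show ?thesis
        using form \<open>v3 \<noteq> 0\<close> by blast
    next
      case False
      \<comment> \<open>After dilation by \<open>v1\<close>, completing the square in the reciprocal of the profile.\<close>
      define w where "w = v3 / v1"
      define a where "a = - (\<epsilon> * w\<^sup>2 + k / v1)"
      have vw: "(1 / v1) *\<^sub>R v = vector [1, w, w]"
        using False by (simp add: v vec_eq_iff forall_3 w_def)
      have f: "v1 * mink (\<gamma>1 s) avec * (a + \<epsilon> * (s - w)\<^sup>2) = - 1" if "s \<in> I" for s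
      proof -
        have "v1 * (a + \<epsilon> * (s - w)\<^sup>2) = - (k - \<epsilon> * (v1 * s\<^sup>2 - 2 * v3 * s))"
          using False by (simp add: a_def w_def power2_eq_square algebra_simps)
        then have "v1 * mink (\<gamma>1 s) avec * (a + \<epsilon> * (s - w)\<^sup>2)
            = - (mink (\<gamma>1 s) avec * (k - \<epsilon> * (v1 * s\<^sup>2 - 2 * v3 * s)))"
          by (simp only: mult_minus_right[symmetric] mult.assoc mult.left_commute[of v1])
        then show ?thesis
          unfolding k[OF that] .
      qed
      consider "a = 0" | "a \<noteq> 0" "sgn \<epsilon> = sgn a" | "a \<noteq> 0" "sgn \<epsilon> = - sgn a"
        using eps by (cases a "0 :: real" rule: linorder_cases) auto
      then show ?thesis
      proof cases
        case 1
        have f0: "v1 * mink (\<gamma>1 s) avec * (\<epsilon> * (s - w)\<^sup>2) = - 1" if "s \<in> I" for s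
          using f[OF that] 1 by simp
        then have sw: "\<forall>s\<in>I. s \<noteq> w" by force
        obtain c b where form: "base_curve_form I (\<lambda>s. v1 *\<^sub>R (\<gamma> s + h s *\<^sub>R ruling s) + c)
            (\<lambda>s. 1 / (\<epsilon> * (s - w)))
            (\<lambda>s. 1 / \<epsilon> * (ln (s - w) - w / (s - w)))
            (\<lambda>s. 1 / (2 * \<epsilon>) * (2 * w * ln (s - w) - (1 + w\<^sup>2) / (s - w)) + b * s)"
          using soliton_profile_rational[OF prof eps f0] by blast
        show ?thesis
          by (rule exI[of _ v1], rule exI[of _ c], rule exI, rule conjI[OF False conjI[OF refl]],
              rule disjI2, rule exI[of _ w], rule conjI[OF vw], rule disjI1,
              rule exI[of _ b], rule conjI[OF sw form])
      next
        case 2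
        define p where "p = sqrt (\<epsilon> / a)"
        define \<phi> where "\<phi> = (\<lambda>s. p * (s - w))"
        obtain c b where form: "base_curve_form I (\<lambda>s. v1 *\<^sub>R (\<gamma> s + h s *\<^sub>R ruling s) + c)
            (\<lambda>s. - (1 / (a * p)) * arctan (\<phi> s))
            (\<lambda>s. 1 / (2 * \<epsilon>) * ln (1 + (\<phi> s)\<^sup>2) + w / (a * p) * arctan (\<phi> s))
            (\<lambda>s. ((p\<^sup>2 * (w\<^sup>2 + 1) - 1) * arctan (\<phi> s) + p * w * ln (1 + (\<phi> s)\<^sup>2))
                  / (2 * \<epsilon> * p) + b * s)"
          using soliton_profile_arctan[OF prof eps f 2(2)] unfolding \<phi>_def p_def by blast
        show ?thesis
          by (rule exI[of _ v1], rule exI[of _ c], rule exI, rule conjI[OF False conjI[OF refl]],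
              rule disjI2, rule exI[of _ w], rule conjI[OF vw], rule disjI2, rule disjI1,
              rule exI[of _ a], rule exI[of _ b], rule exI[of _ p], rule exI[of _ \<phi>], intro conjI,
              rule 2(1), rule 2(2), rule p_def, rule \<phi>_def, rule form)
      next
        case 3
        define p where "p = sqrt (- \<epsilon> / a)"
        define \<phi> where "\<phi> = (\<lambda>s. p * (s - w))"
        have nz: "\<forall>s\<in>I. (\<phi> s)\<^sup>2 \<noteq> 1"
          using soliton_profile_artanh(1)[OF prof eps f 3] unfolding \<phi>_def p_def by blast
        obtain c b where form: "base_curve_form I (\<lambda>s. v1 *\<^sub>R (\<gamma> s + h s *\<^sub>R ruling s) + c)
            (\<lambda>s. - (1 / (2 * p * a)) * ln ((1 + \<phi> s) / (1 - \<phi> s)))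
            (\<lambda>s. 1 / (2 * \<epsilon>) * ln (1 - (\<phi> s)\<^sup>2) + w / (2 * a * p) * ln ((1 + \<phi> s) / (1 - \<phi> s)))
            (\<lambda>s. \<epsilon> * w / 2 * ln (1 - (\<phi> s)\<^sup>2)
                  + (1 - a * \<epsilon> + w\<^sup>2) / (2 * a * p) * artanh (\<phi> s) + b * s)"
          using soliton_profile_artanh(2)[OF prof eps f 3] unfolding \<phi>_def p_def by blast
        show ?thesis
          by (rule exI[of _ v1], rule exI[of _ c], rule exI, rule conjI[OF False conjI[OF refl]],
              rule disjI2, rule exI[of _ w], rule conjI[OF vw], rule disjI2, rule disjI2,
              rule exI[of _ a], rule exI[of _ b], rule exI[of _ p], rule exI[of _ \<phi>], intro conjI,
              rule 3(1), rule 3(2), rule p_def, rule \<phi>_def, rule nz, rule form)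
      qed
    qed
  qed
qed

end
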